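(* Let $r=1$ and let $\mathfrak{g}$ be of type $D_{n+1}^{(2)}$ or $A_{2n}^{(2)}$. For every soliton $p=b_{-L}\otimes\cdots\otimes b_0\in\mathcal{S}^{(1)}(\ell)$ of length $\ell$ in the soliton cellular automaton using $B^{1,1}$, we have $$u<b_{-L}\leq\cdots\leq b_0,$$ where $y_1$ appears at most once, $\emptyset$ appears at most once, and the order on $B(\overline\Lambda_1)$ is extended to $B^{1,1}=B(\overline\Lambda_1)\sqcup\{\emptyset\}$ by $v<\emptyset$. Moreover, $\ell=L+m_v+1$, where $m_v$ is the number of factors of $p$ equal to $v$.
   Context: **Lie algebra data.** $\mathfrak{g}$ is an affine Kac--Moody algebra with index set $I$ (Kac labelling), $I_0=I\setminus\{0\}$, $\mathfrak{g}_0$ the finite-type algebra on $I_0$ (type $B_n$ for $D_{n+1}^{(2)}$, type $C_n$ for $A_{2n}^{(2)}$), $\overline\Lambda_i$ its fundamental weights. **Crystals.** Crystals are seminormal: $\varepsilon_i(b)=\max\{k\mid e_i^kb\ne0\}$, $\varphi_i(b)=\max\{k\mid f_i^kb\neq0\}$. Tensor products use the convention opposite to Kashiwara: $f_i(b_2\otimes b_1)=f_ib_2\otimes b_1$ if $\varepsilon_i(b_2)\geq\varphi_i(b_1)$ and $b_2\otimes f_ib_1$ otherwise; $e_i(b_2\otimes b_1)=e_ib_2\otimes b_1$ if $\varepsilon_i(b_2)>\varphi_i(b_1)$ and $b_2\otimes e_ib_1$ otherwise. $B(\lambda)$ is the highest weight crystal with highest weight element $u_\lambda$; it is a poset with $b\leq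 b'$ if $b'=f_{i_m}\cdots f_{i_1}b$ for some $i_1,\dots,i_m\in I_0$. **KR crystals.** $B^{1,1}$ is the Kirillov--Reshetikhin $U_q'(\mathfrak{g})$-crystal; as a $U_q(\mathfrak{g}_0)$-crystal $B^{1,1}\cong B(\overline\Lambda_1)\oplus B(0)$, and $\emptyset$ is the element of $B(0)$. $u=u_{\overline\Lambda_1}$ is the highest weight element of $B(\overline\Lambda_1)$ and $v$ the unique element of weight $-\overline\Lambda_1$. $y_1$ is the unique element of weight $0$ in $B(\overline\Lambda_1)$ when it exists (type $D_{n+1}^{(2)}$). **Combinatorial $R$-matrix and local energy.** $R\colon B\otimes B'\to B'\otimes B$ is the unique $U_q'(\mathfrak{g})$-crystal isomorphism for KR crystals $B,B'$. The local energy $H\colon B\otimes B'\to\mathbb{Z}$ is invariant under $e_i$, $i\in I_0$; and if $R(b\otimes b')=\widetilde b'\otimes\widetilde b$, then $H(e_0(b\otimes b'))-H(b\otimes b')$ is $-1$ if $e_0$ acts on the left factor of both $b\otimes b'$ and $\widetilde b'\otimes\widetilde b$, $+1$ if it acts on the right factor of both, and $0$ otherwise. It is normalized by $H(u(B)\otimes u(B'))=0$, where $u(B^{r,s})$ is the unique element of classical weight $s\overline\Lambda_r$. **Soliton cellular automaton.** Put $r=1$. A state is an element $\cdots\otimes b_{-2}\otimes b_{-1}\otimes b_0$ with $b_{-k}\in B^{r,1}$ and $b_{-k}=u$ for $k\gg0$. Its energy is $E_1(b)=\sum_{k\ge0}H(b_{-k}\otimes b_{-k+1})$ with $b_1:=u$.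 A soliton is a tensor product $b_{-L}\otimes\cdots\otimes b_0$ with all $b_k\ne u$ such that the state $\cdots\otimes u\otimes u\otimes b_{-L}\otimes\cdots\otimes b_0$ has $E_1=H(f_ru\otimes u)$. Its length is $\sum_{k=0}^LN_r(b_{-k})$, where $N_r(\emptyset)=1$ and otherwise $N_r(b)$ is the number of $a$ with $i_a=r$ in any expression $e_{i_1}\cdots e_{i_m}b=u$ ($i_a\in I_0$). $\mathcal{S}^{(r)}(\ell)$ is the set of solitons of length $\ell$.
   Formalization: The rank is taken to be n ≥ 2 (as in Kac's tables); for A_2^{(2)} the length formula fails, since the single factor v = f_1 u is a soliton of length 1 while L + m_v + 1 = 2, and for D_{n+1}^{(2)} with n = 1 no such B^{1,1} exists. *)

theory Defs
  imports "HOL-Library.Groups_Big_Fun"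
begin

subsection \<open>Types and Cartan matrices\<close>

text \<open>
  \<open>D_twisted\<close> with parameter n is \<open>D_{n+1}^{(2)}\<close> and \<open>A_twisted\<close> is \<open>A_{2n}^{(2)}\<close>, both for
  n at least 2.  The index set is I = {0..n}, and \<open>I_0\<close> = {1..n}.
\<close>

datatype affine_type = D_twisted | A_twisted

text \<open>
  The entry (i, j) is \<open>\<langle>h_i, \<alpha>_j\<rangle>\<close>, in Kac's labelling.  For both types
  \<open>\<alpha>_0\<close> is shorter than \<open>\<alpha>_1\<close>.  Deleting the node 0 leaves \<open>B_n\<close> (\<open>\<alpha>_n\<close> short) for
  \<open>D_{n+1}^{(2)}\<close> and \<open>C_n\<close> (\<open>\<alpha>_n\<close> long) for \<open>A_{2n}^{(2)}\<close>.
\<close>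

definition cartan :: "affine_type \<Rightarrow> nat \<Rightarrow> nat \<Rightarrow> nat \<Rightarrow> int" where
  "cartan ty n i j =
    (if i = j then 2
     else if i = 0 \<and> j = 1 then - 2
     else if ty = D_twisted \<and> i = n \<and> Suc j = n then - 2
     else if ty = A_twisted \<and> Suc i = n \<and> j = n then - 2
     else if j = Suc i \<or> i = Suc j then - 1
     else 0)"

subsection \<open>Seminormal crystals\<close>

text \<open>\<open>None\<close> stands for the element 0 that is adjoined to a crystal.\<close>

record 'a crystal =
  elts :: "'a set"
  eop :: "nat \<Rightarrow> 'a \<Rightarrow> 'a option"
  fop :: "nat \<Rightarrow> 'a \<Rightarrow> 'a option"

definition iter_op :: "('a \<Rightarrow> 'a option) \<Rightarrow> nat \<Rightarrow> 'a \<Rightarrow> 'a option" where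
  "iter_op g k b = ((\<lambda>x. Option.bind x g) ^^ k) (Some b)"

definition eps :: "'a crystal \<Rightarrow> nat \<Rightarrow> 'a \<Rightarrow> nat" where
  "eps C i b = Max {k. iter_op (eop C i) k b \<noteq> None}"

definition phi :: "'a crystal \<Rightarrow> nat \<Rightarrow> 'a \<Rightarrow> nat" where
  "phi C i b = Max {k. iter_op (fop C i) k b \<noteq> None}"

text \<open>
  A weight is given by its coordinates with respect to the fundamental weights \<open>\<Lambda>_i\<close>.  For
  \<open>U_q'(g)\<close> weights are taken modulo \<open>\<delta>\<close>, and so they too are determined by these coordinates.
  In a seminormal crystal \<open>\<langle>h_i, wt b\<rangle> = \<phi>_i(b) - \<epsilon>_i(b)\<close>; hence the weight
  map is not an independent datum.
\<close>

type_synonym weight = "nat \<Rightarrow> int"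

definition wt :: "'a crystal \<Rightarrow> 'a \<Rightarrow> weight" where
  "wt C b = (\<lambda>i. int (phi C i b) - int (eps C i b))"

definition fund :: "nat \<Rightarrow> weight" where
  "fund r = (\<lambda>i. if i = r then 1 else 0)"

text \<open>
  Seminormal crystals for the Cartan matrix \<open>A\<close> restricted to the index set \<open>J\<close>.  The operators
  with an index outside \<open>J\<close> are ignored; this is how restriction from g to \<open>g_0\<close> is expressed.
\<close>

definition is_crystal :: "(nat \<Rightarrow> nat \<Rightarrow> int) \<Rightarrow> nat set \<Rightarrow> 'a crystal \<Rightarrow> bool" where
  "is_crystal A J C \<longleftrightarrow>
     (\<forall>i\<in>J. \<forall>b\<in>elts C. set_option (eop C i b) \<subseteq> elts C \<and> set_option (fop C i b) \<subseteq> elts C) \<and>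
     (\<forall>i\<in>J. \<forall>b\<in>elts C. \<forall>b'\<in>elts C. fop C i b = Some b' \<longleftrightarrow> eop C i b' = Some b) \<and>
     (\<forall>i\<in>J. \<forall>b\<in>elts C. \<exists>k. iter_op (eop C i) k b = None) \<and>
     (\<forall>i\<in>J. \<forall>b\<in>elts C. \<exists>k. iter_op (fop C i) k b = None) \<and>
     (\<forall>i\<in>J. \<forall>b\<in>elts C. \<forall>b'. fop C i b = Some b' \<longrightarrow>
        (\<forall>j\<in>J. wt C b' j = wt C b j - A j i))"

definition crystal_iso :: "nat set \<Rightarrow> 'a crystal \<Rightarrow> 'b crystal \<Rightarrow> ('a \<Rightarrow> 'b) \<Rightarrow> bool" where
  "crystal_iso J C D \<psi> \<longleftrightarrow>
     bij_betw \<psi> (elts C) (elts D) \<and>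
     (\<forall>i\<in>J. \<forall>b\<in>elts C. eop D i (\<psi> b) = map_option \<psi> (eop C i b) \<and>
                        fop D i (\<psi> b) = map_option \<psi> (fop C i b))"

definition subcrystal :: "'a set \<Rightarrow> 'a crystal \<Rightarrow> 'a crystal" where
  "subcrystal X C = C\<lparr>elts := X\<rparr>"

definition arrows :: "nat set \<Rightarrow> 'a crystal \<Rightarrow> ('a \<times> 'a) set" where
  "arrows J C = {(b, b'). b \<in> elts C \<and> (\<exists>i\<in>J. fop C i b = Some b')}"

definition component :: "nat set \<Rightarrow> 'a crystal \<Rightarrow> 'a \<Rightarrow> 'a crystal" where
  "component J C b = subcrystal {b'. (b, b') \<in> (arrows J C \<union> (arrows J C)\<inverse>)\<^sup>*} C"

definition connected_crystal :: "nat set \<Rightarrow> 'a crystal \<Rightarrow> bool" where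
  "connected_crystal J C \<longleftrightarrow>
     (\<forall>b\<in>elts C. \<forall>b'\<in>elts C. (b, b') \<in> (arrows J C \<union> (arrows J C)\<inverse>)\<^sup>*)"

text \<open>
  The pair \<open>(x, y)\<close> stands for the tensor product of \<open>x\<close> (left factor) and \<open>y\<close> (right factor),
  in the convention opposite to Kashiwara's.
\<close>

definition tensor :: "'a crystal \<Rightarrow> 'b crystal \<Rightarrow> ('a \<times> 'b) crystal" where
  "tensor C D =
     \<lparr> elts = elts C \<times> elts D,
       eop = (\<lambda>i (x, y). if eps C i x > phi D i y
                         then map_option (\<lambda>x'. (x', y)) (eop C i x)
                         else map_option (\<lambda>y'. (x, y')) (eop D i y)),
       fop = (\<lambda>i (x, y). if eps C i x \<ge> phi D i y
                         then map_option (\<lambda>x'. (x', y)) (fop C i x)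
                         else map_option (\<lambda>y'. (x, y')) (fop D i y)) \<rparr>"

subsection \<open>The highest weight crystals\<close>

definition dominant :: "nat set \<Rightarrow> weight \<Rightarrow> bool" where
  "dominant J \<nu> \<longleftrightarrow> (\<forall>i\<in>J. \<nu> i \<ge> 0) \<and> (\<forall>i. i \<notin> J \<longrightarrow> \<nu> i = 0)"

definition generated_by_hw ::
  "(nat \<Rightarrow> nat \<Rightarrow> int) \<Rightarrow> nat set \<Rightarrow> weight \<Rightarrow> 'a crystal \<Rightarrow> 'a \<Rightarrow> bool" where
  "generated_by_hw A J \<nu> C u \<longleftrightarrow>
     is_crystal A J C \<and> u \<in> elts C \<and>
     (\<forall>i\<in>J. eop C i u = None) \<and> (\<forall>i\<in>J. wt C u i = \<nu> i) \<and>
     (\<forall>b\<in>elts C. (u, b) \<in> (arrows J C)\<^sup>*)"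

text \<open>
  A family of crystals generated by highest weight elements, one for every dominant weight, is
  closed if the component of \<open>u_\<nu> \<otimes> u_\<mu>\<close> in the tensor product of the members of weights
  \<open>\<nu>\<close> and \<open>\<mu>\<close> is the member of weight \<open>\<nu> + \<mu>\<close>.  By a theorem of Joseph the crystals
  \<open>B(\<nu>)\<close> of the irreducible highest weight modules form the only such family up to
  isomorphism.  They are countable, so the carrier type \<open>nat\<close> is no restriction.
\<close>

definition closed_family ::
  "(nat \<Rightarrow> nat \<Rightarrow> int) \<Rightarrow> nat set \<Rightarrow> (weight \<Rightarrow> nat crystal) \<Rightarrow> (weight \<Rightarrow> nat) \<Rightarrow> bool" where
  "closed_family A J F U \<longleftrightarrow>
     (\<forall>\<nu>. dominant J \<nu> \<longrightarrow> generated_by_hw A J \<nu> (F \<nu>) (U \<nu>)) \<and>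
     (\<forall>\<nu> \<mu>. dominant J \<nu> \<longrightarrow> dominant J \<mu> \<longrightarrow>
        (\<exists>\<psi>. crystal_iso J (component J (tensor (F \<nu>) (F \<mu>)) (U \<nu>, U \<mu>))
                            (F (\<lambda>i. \<nu> i + \<mu> i)) \<psi>))"

definition is_hw_crystal ::
  "(nat \<Rightarrow> nat \<Rightarrow> int) \<Rightarrow> nat set \<Rightarrow> weight \<Rightarrow> 'a crystal \<Rightarrow> bool" where
  "is_hw_crystal A J \<nu> C \<longleftrightarrow>
     is_crystal A J C \<and>
     (\<exists>F U \<psi>. closed_family A J F U \<and> crystal_iso J C (F \<nu>) \<psi>)"

subsection \<open>The Kirillov--Reshetikhin crystal\<close>

text \<open>
  \<open>B\<close> is a finite connected crystal for \<open>U_q'(g)\<close> whose restriction to \<open>g_0\<close> is the direct sum of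
  \<open>X\<close>, a copy of \<open>B(\<Lambda>_1)\<close>, and the one-element crystal \<open>{z}\<close>, a copy of \<open>B(0)\<close>;
  thus \<open>z\<close> is the element denoted by the empty set sign.  The Kirillov--Reshetikhin crystal has
  these properties, and they determine it up to isomorphism:  the operator
  \<open>f_0\<close> adds \<open>\<Lambda>_1\<close> to the classical weight and the level is zero, so the 0-arrows run
  from \<open>v\<close> to a weight 0 element and from there to \<open>u\<close>; by connectedness that element
  is \<open>z\<close>.
\<close>

definition is_KR11 ::
  "affine_type \<Rightarrow> nat \<Rightarrow> 'a crystal \<Rightarrow> 'a set \<Rightarrow> 'a \<Rightarrow> bool" where
  "is_KR11 ty n B X z \<longleftrightarrow>
     is_crystal (cartan ty n) {0..n} B \<and> finite (elts B) \<and> connected_crystal {0..n} B \<and>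
     elts B = X \<union> {z} \<and> z \<notin> X \<and>
     is_hw_crystal (cartan ty n) {1..n} (fund 1) (subcrystal X B) \<and>
     is_hw_crystal (cartan ty n) {1..n} (\<lambda>_. 0) (subcrystal {z} B)"

definition elt_of_wt :: "nat \<Rightarrow> 'a crystal \<Rightarrow> weight \<Rightarrow> 'a" where
  "elt_of_wt n B \<nu> = (THE b. b \<in> elts B \<and> (\<forall>i\<in>{1..n}. wt B b i = \<nu> i))"

definition u_elt :: "nat \<Rightarrow> 'a crystal \<Rightarrow> 'a" where
  "u_elt n B = elt_of_wt n B (fund 1)"

definition v_elt :: "nat \<Rightarrow> 'a crystal \<Rightarrow> 'a" where
  "v_elt n B = elt_of_wt n B (\<lambda>i. - fund 1 i)"

text \<open>
  The order of \<open>B(\<Lambda>_1)\<close> (reachability by the \<open>f_i\<close> with i in \<open>I_0\<close>), extended to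
  \<open>z\<close> by the relation \<open>v < z\<close>.
\<close>

definition kr_le :: "nat \<Rightarrow> 'a crystal \<Rightarrow> 'a set \<Rightarrow> 'a \<Rightarrow> 'a \<Rightarrow> 'a \<Rightarrow> bool" where
  "kr_le n B X z b b' \<longleftrightarrow> (b, b') \<in> (arrows {1..n} (subcrystal X B) \<union> {(v_elt n B, z)})\<^sup>*"

definition kr_less :: "nat \<Rightarrow> 'a crystal \<Rightarrow> 'a set \<Rightarrow> 'a \<Rightarrow> 'a \<Rightarrow> 'a \<Rightarrow> bool" where
  "kr_less n B X z b b' \<longleftrightarrow> kr_le n B X z b b' \<and> b \<noteq> b'"

subsection \<open>Combinatorial R-matrix and local energy\<close>

definition combinatorial_R ::
  "nat \<Rightarrow> 'a crystal \<Rightarrow> 'b crystal \<Rightarrow> ('a \<times> 'b \<Rightarrow> 'b \<times> 'a) \<Rightarrow> bool" where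
  "combinatorial_R n B B' R \<longleftrightarrow> crystal_iso {0..n} (tensor B B') (tensor B' B) R"

definition e0_acts_left :: "'a crystal \<Rightarrow> 'b crystal \<Rightarrow> 'a \<times> 'b \<Rightarrow> bool" where
  "e0_acts_left B B' p \<longleftrightarrow> eps B 0 (fst p) > phi B' 0 (snd p)"

text \<open>\<open>u\<close> and \<open>u'\<close> are the elements of \<open>B\<close> and \<open>B'\<close> used for the normalization.\<close>

definition local_energy ::
  "nat \<Rightarrow> 'a crystal \<Rightarrow> 'b crystal \<Rightarrow> ('a \<times> 'b \<Rightarrow> 'b \<times> 'a) \<Rightarrow> 'a \<Rightarrow> 'b \<Rightarrow> ('a \<times> 'b \<Rightarrow> int) \<Rightarrow> bool"
where
  "local_energy n B B' R u u' H \<longleftrightarrow>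
     (\<forall>i\<in>{1..n}. \<forall>p\<in>elts B \<times> elts B'. \<forall>q. eop (tensor B B') i p = Some q \<longrightarrow> H q = H p) \<and>
     (\<forall>p\<in>elts B \<times> elts B'. \<forall>q. eop (tensor B B') 0 p = Some q \<longrightarrow>
        H q - H p =
          (if e0_acts_left B B' p \<and> e0_acts_left B' B (R p) then - 1
           else if \<not> e0_acts_left B B' p \<and> \<not> e0_acts_left B' B (R p) then 1
           else 0)) \<and>
     H (u, u') = 0"

subsection \<open>States and solitons\<close>

text \<open>A state \<open>s\<close> lists the factors from right to left: \<open>s k\<close> is the factor \<open>b_{-k}\<close>.\<close>

definition is_state :: "'a crystal \<Rightarrow> 'a \<Rightarrow> (nat \<Rightarrow> 'a) \<Rightarrow> bool" where
  "is_state B u s \<longleftrightarrow> (\<forall>k. s k \<in> elts B) \<and> (\<exists>K. \<forall>k\<ge>K. s k = u)"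

text \<open>
  \<open>Sum_any\<close> sums over the support of its argument.  The support is finite for every state,
  since \<open>H (u, u) = 0\<close>.
\<close>

definition energy :: "('a \<times> 'a \<Rightarrow> int) \<Rightarrow> 'a \<Rightarrow> (nat \<Rightarrow> 'a) \<Rightarrow> int" where
  "energy H u s = Sum_any (\<lambda>k. H (s k, if k = 0 then u else s (k - 1)))"

text \<open>
  A list \<open>[b_{-L}, ..., b_0]\<close> has the tensor product order, so it has to be reversed when
  it is padded on the left by copies of \<open>u\<close> to form a state.
\<close>

definition state_of :: "'a \<Rightarrow> 'a list \<Rightarrow> nat \<Rightarrow> 'a" where
  "state_of u p k = (if k < length p then rev p ! k else u)"

definition is_soliton :: "nat \<Rightarrow> 'a crystal \<Rightarrow> ('a \<times> 'a \<Rightarrow> int) \<Rightarrow> 'a list \<Rightarrow> bool" where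
  "is_soliton n B H p \<longleftrightarrow>
     (let u = u_elt n B; s = state_of u p in
        p \<noteq> [] \<and> u \<notin> set p \<and> is_state B u s \<and>
        energy H u s = H (the (fop B 1 u), u))"

text \<open>
  \<open>apply_es C w b\<close> is \<open>e_{i_1} \<cdots> e_{i_m} b\<close> for the word \<open>w = [i_1, ..., i_m]\<close>; the last
  letter acts first.
\<close>

definition apply_es :: "'a crystal \<Rightarrow> nat list \<Rightarrow> 'a \<Rightarrow> 'a option" where
  "apply_es C w b = foldr (\<lambda>i x. Option.bind x (eop C i)) w (Some b)"

text \<open>The number of letters 1 is the same for all words \<open>w\<close> in question.\<close>

definition N1 :: "nat \<Rightarrow> 'a crystal \<Rightarrow> 'a \<Rightarrow> 'a \<Rightarrow> nat" where
  "N1 n B z b =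
     (if b = z then 1
      else (THE k. \<exists>w. set w \<subseteq> {1..n} \<and> apply_es B w b = Some (u_elt n B) \<and> k = count_list w 1))"

definition soliton_length :: "nat \<Rightarrow> 'a crystal \<Rightarrow> 'a \<Rightarrow> 'a list \<Rightarrow> nat" where
  "soliton_length n B z p = sum_list (map (N1 n B z) p)"

definition solitons ::
  "nat \<Rightarrow> 'a crystal \<Rightarrow> 'a \<Rightarrow> ('a \<times> 'a \<Rightarrow> int) \<Rightarrow> nat \<Rightarrow> 'a list set" where
  "solitons n B z H l = {p. is_soliton n B H p \<and> soliton_length n B z p = l}"

end

(* The classical arrows make B(Lambda_1) a chain c_0 -> ... -> c_m from u to v.  A weight argument
   and connectedness then force the 0-arrows to be v -> empt -> u.  The combinatorial R-matrix fixes
   u (x) u and everything connected to it, so the local energy can be read off: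
   H(c_a (x) c_b) is 0 if a <= b, unless c_a = c_b has weight 0, and -2 otherwise;
   H(empt (x) c_b) = H(c_a (x) empt) = -1 and H(empt (x) empt) = -2.
   Since H <= 0 and a soliton has energy -2, its whole energy comes from its last factor b_0 together
   with the u that follows it (b_0 in X), or from the two pairs around its last factor (b_0 = empt);
   all other pairs have energy 0. *)
theory Submission
  imports Defs
begin

subsection \<open>Strings and isomorphisms\<close>

text \<open>The classical part is given abstractly, so its arrows have to be recovered from weights:
  once the arrows into an element are known, so is \<open>eps\<close>, and the weight then yields
  \<open>phi\<close>, that is, the arrows out of it. The integer \<open>height\<close> does the
  bookkeeping. Every classical \<open>f_i\<close> lowers it by 4, and \<open>f_0\<close> raises it
  by 2m, half of the distance between v and u.

  Weights alone do not settle the 0-arrows in type \<open>D_{n+1}^{(2)}\<close>: there c_n has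
  weight 0 just like the empty element, and v -> c_n -> u is compatible with all weights. That
  alternative would isolate the empty element.

  The rule for \<open>e_0\<close> in the local energy involves R and can be evaluated only where R
  is known; hence all 0-steps are taken at elements already shown to be fixed by R. Three of them
  suffice to reach X (x) X, whose classical highest weight elements are u (x) u, c_1 (x) u and v (x)
  u. The exception at weight 0 reflects the n-string of length 2 in type \<open>B_n\<close>.\<close>

lemma iter_op_0: "iter_op g 0 b = Some b"
  by (simp add: iter_op_def)

lemma iter_op_Suc: "iter_op g (Suc k) b = Option.bind (g b) (iter_op g k)"
proof -
  have "((\<lambda>x. Option.bind x g) ^^ k) None = None"
    by (induction k) auto
  then show ?thesis
    by (cases "g b") (auto simp: iter_op_def funpow_Suc_right simp del: funpow.simps)
qed

lemma Max_iter_op_None: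
  assumes "g b = None"
  shows "Max {k. iter_op g k b \<noteq> None} = 0"
proof -
  have "k \<in> {k. iter_op g k b \<noteq> None} \<longleftrightarrow> k \<in> {0}" for k
    using assms by (cases k) (simp_all add: iter_op_0 iter_op_Suc)
  then have "{k. iter_op g k b \<noteq> None} = {0}" by blast
  then show ?thesis by simp
qed

text \<open>The exponents for \<open>b\<close> are 0 and the successors of those for
  \<open>b'\<close>. Since iteration stays at \<open>None\<close>, \<open>fin\<close> bounds both
  sets; \<open>Max\<close> of an infinite set would be an unspecified value.\<close>

lemma Max_iter_op_Some:
  assumes g: "g b = Some b'" and fin: "iter_op g K b = None"
  shows "Max {k. iter_op g k b \<noteq> None} = Suc (Max {k. iter_op g k b' \<noteq> None})"
proof -
  let ?S = "{k. iter_op g k b' \<noteq> None}"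
  have eq: "{k. iter_op g k b \<noteq> None} = insert 0 (Suc ` ?S)"
  proof (rule set_eqI)
    fix k
    show "k \<in> {k. iter_op g k b \<noteq> None} \<longleftrightarrow> k \<in> insert 0 (Suc ` ?S)"
      by (cases k) (auto simp: iter_op_0 iter_op_Suc g)
  qed
  obtain K' where K': "iter_op g K' b' = None"
    using fin g by (cases K) (auto simp: iter_op_0 iter_op_Suc)
  have step: "iter_op g (Suc k) b' = None" if "iter_op g k b' = None" for k
    using that by (simp add: iter_op_def)
  have above: "iter_op g k b' = None" if "K' \<le> k" for k
    using that by (induction rule: dec_induct) (auto simp: K' step)
  have "?S \<subseteq> {..<K'}"
  proof
    fix k assume "k \<in> ?S"
    then show "k \<in> {..<K'}" using above[of k] by (cases "K' \<le> k") simp_all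
  qed
  then have "finite ?S" using finite_subset by blast
  moreover have "0 \<in> ?S" by (simp add: iter_op_0)
  ultimately have "Max (Suc ` ?S) = Suc (Max ?S)"
    using mono_Max_commute[OF mono_Suc, of ?S] by (metis empty_iff)
  moreover have "Max (insert 0 (Suc ` ?S)) = max 0 (Max (Suc ` ?S))"
    using \<open>finite ?S\<close> \<open>0 \<in> ?S\<close> by (intro Max_insert) blast+
  ultimately show ?thesis unfolding eq by simp
qed

lemma crystal_ops_closed:
  assumes "is_crystal A J C" "i \<in> J" "b \<in> elts C"
  shows "eop C i b = Some b' \<Longrightarrow> b' \<in> elts C" "fop C i b = Some b' \<Longrightarrow> b' \<in> elts C"
proof -
  have "set_option (eop C i b) \<subseteq> elts C" "set_option (fop C i b) \<subseteq> elts C"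
    using assms unfolding is_crystal_def by blast+
  then show "eop C i b = Some b' \<Longrightarrow> b' \<in> elts C" "fop C i b = Some b' \<Longrightarrow> b' \<in> elts C"
    by auto
qed

lemma crystal_eop_fop:
  assumes "is_crystal A J C" "i \<in> J" "b \<in> elts C"
  shows "fop C i b = Some b' \<Longrightarrow> eop C i b' = Some b" "eop C i b = Some b' \<Longrightarrow> fop C i b' = Some b"
proof -
  have *: "\<forall>b\<in>elts C. \<forall>b'\<in>elts C. fop C i b = Some b' \<longleftrightarrow> eop C i b' = Some b"
    using assms(1,2) unfolding is_crystal_def by blast
  show "fop C i b = Some b' \<Longrightarrow> eop C i b' = Some b" "eop C i b = Some b' \<Longrightarrow> fop C i b' = Some b"
    using * assms(3) crystal_ops_closed[OF assms] by blast+
qed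

lemma crystal_wt:
  assumes "is_crystal A J C" "i \<in> J" "j \<in> J" "b \<in> elts C" "fop C i b = Some b'"
  shows "wt C b' j = wt C b j - A j i"
  using assms unfolding is_crystal_def by blast

lemma eps_None: "eop C i b = None \<Longrightarrow> eps C i b = 0"
  unfolding eps_def by (rule Max_iter_op_None)

lemma phi_None: "fop C i b = None \<Longrightarrow> phi C i b = 0"
  unfolding phi_def by (rule Max_iter_op_None)

lemma eps_Some:
  assumes "is_crystal A J C" "i \<in> J" "b \<in> elts C" "eop C i b = Some b'"
  shows "eps C i b = Suc (eps C i b')"
proof -
  obtain K where "iter_op (eop C i) K b = None"
    using assms unfolding is_crystal_def by blast
  then show ?thesis
    unfolding eps_def using Max_iter_op_Some assms(4) by metis
qed

lemma phi_Some:
  assumes "is_crystal A J C" "i \<in> J" "b \<in> elts C" "fop C i b = Some b'"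
  shows "phi C i b = Suc (phi C i b')"
proof -
  obtain K where "iter_op (fop C i) K b = None"
    using assms unfolding is_crystal_def by blast
  then show ?thesis
    unfolding phi_def using Max_iter_op_Some assms(4) by metis
qed

lemma subcrystal_simps [simp]:
  "elts (subcrystal X C) = X" "eop (subcrystal X C) = eop C" "fop (subcrystal X C) = fop C"
  "eps (subcrystal X C) = eps C" "phi (subcrystal X C) = phi C" "wt (subcrystal X C) = wt C"
  by (auto simp: subcrystal_def eps_def phi_def wt_def fun_eq_iff)

lemma iter_op_iso:
  assumes "\<And>b b'. b \<in> S \<Longrightarrow> g b = Some b' \<Longrightarrow> b' \<in> S"
    and "\<And>b. b \<in> S \<Longrightarrow> g' (\<psi> b) = map_option \<psi> (g b)" and "b \<in> S"
  shows "iter_op g' k (\<psi> b) = map_option \<psi> (iter_op g k b)"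
  using assms(3)
proof (induction k arbitrary: b)
  case (Suc k)
  then show ?case
    by (cases "g b") (auto simp: iter_op_Suc assms(2) dest: assms(1))
qed (simp add: iter_op_0)

lemma wt_iso:
  assumes C: "is_crystal A J C" and iso: "crystal_iso J C D \<psi>" and "b \<in> elts C" "i \<in> J"
  shows "wt D (\<psi> b) i = wt C b i"
proof -
  have "iter_op (eop D i) k (\<psi> b) = map_option \<psi> (iter_op (eop C i) k b)" for k
    by (rule iter_op_iso[where S = "elts C"])
      (use iso assms(3,4) crystal_ops_closed(1)[OF C assms(4)] in \<open>simp_all add: crystal_iso_def\<close>)
  moreover have "iter_op (fop D i) k (\<psi> b) = map_option \<psi> (iter_op (fop C i) k b)" for k
    by (rule iter_op_iso[where S = "elts C"])
      (use iso assms(3,4) crystal_ops_closed(2)[OF C assms(4)] in \<open>simp_all add: crystal_iso_def\<close>)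
  ultimately show ?thesis by (simp add: wt_def eps_def phi_def)
qed


text \<open>Transports generation against \<open>\<psi>\<close>, from a member of a closed family to
  a crystal isomorphic to it. A path in \<open>D\<close> lifts arrow by arrow, and injectivity
  identifies its end.\<close>

lemma generated_by_hw_iso:
  assumes C: "is_crystal A J C" and iso: "crystal_iso J C D \<psi>"
    and gen: "generated_by_hw A J \<nu> D U"
  shows "\<exists>u. generated_by_hw A J \<nu> C u"
proof -
  have bij: "bij_betw \<psi> (elts C) (elts D)" using iso by (simp add: crystal_iso_def)
  have ops: "eop D i (\<psi> b) = map_option \<psi> (eop C i b)" "fop D i (\<psi> b) = map_option \<psi> (fop C i b)"
    if "i \<in> J" "b \<in> elts C" for i b
    using iso that by (auto simp: crystal_iso_def)
  from gen have U: "U \<in> elts D" "\<And>i. i \<in> J \<Longrightarrow> eop D i U = None" "\<And>i. i \<in> J \<Longrightarrow> wt D U i = \<nu> i"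
    and reach: "\<And>d. d \<in> elts D \<Longrightarrow> (U, d) \<in> (arrows J D)\<^sup>*"
    by (auto simp: generated_by_hw_def)
  obtain u where u: "u \<in> elts C" "\<psi> u = U" using U(1) bij unfolding bij_betw_def by (metis imageE)
  have lift: "\<exists>c. c \<in> elts C \<and> \<psi> c = d \<and> (u, c) \<in> (arrows J C)\<^sup>*" if "(U, d) \<in> (arrows J D)\<^sup>*" for d
    using that
  proof (induction rule: rtrancl_induct)
    case base
    show ?case using u by blast
  next
    case (step d d')
    then obtain c where c: "c \<in> elts C" "\<psi> c = d" "(u, c) \<in> (arrows J C)\<^sup>*" by blast
    from step(2) obtain i where i: "i \<in> J" "fop D i d = Some d'" by (auto simp: arrows_def)
    with ops(2)[OF i(1) c(1)] c obtain c' where c': "fop C i c = Some c'" "\<psi> c' = d'" by (auto simp: eq_commute[of "Some d'"])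
    have "(c, c') \<in> arrows J C" using c i c' by (auto simp: arrows_def)
    then have "(u, c') \<in> (arrows J C)\<^sup>*" using c(3) by (rule rtrancl_into_rtrancl[rotated])
    moreover have "c' \<in> elts C" by (rule crystal_ops_closed(2)[OF C i(1) c(1) c'(1)])
    ultimately show ?case using c'(2) by blast
  qed
  have "(u, b) \<in> (arrows J C)\<^sup>*" if "b \<in> elts C" for b
  proof -
    have "\<psi> b \<in> elts D" using bij that by (auto simp: bij_betw_def)
    from lift[OF reach[OF this]] obtain c where "c \<in> elts C" "\<psi> c = \<psi> b" "(u, c) \<in> (arrows J C)\<^sup>*"
      by blast
    moreover from this have "c = b" using bij that by (auto simp: bij_betw_def dest: inj_onD)
    ultimately show ?thesis by simp
  qed
  moreover have "eop C i u = None" "wt C u i = \<nu> i" if "i \<in> J" for i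
    using U(2,3)[OF that] ops(1)[OF that u(1)] wt_iso[OF C iso u(1) that] u(2) by auto
  ultimately show ?thesis using C u by (auto simp: generated_by_hw_def)
qed

lemma is_hw_crystal_generated:
  assumes "is_hw_crystal A J \<nu> C" "dominant J \<nu>"
  shows "\<exists>u. generated_by_hw A J \<nu> C u"
proof -
  obtain F U \<psi> where C: "is_crystal A J C" "crystal_iso J C (F \<nu>) \<psi>" and F: "closed_family A J F U"
    using assms(1) unfolding is_hw_crystal_def by blast
  have "generated_by_hw A J \<nu> (F \<nu>) (U \<nu>)"
    using F assms(2) unfolding closed_family_def by blast
  then show ?thesis by (rule generated_by_hw_iso[OF C])
qed

subsection \<open>The crystal of the first fundamental weight\<close>

text \<open>
  The vector crystal is the chain with labels 1, ..., n, n, ..., 1 in type \<open>B_n\<close> and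
  1, ..., n - 1, n, n - 1, ..., 1 in type \<open>C_n\<close>.  The n-string of length 2 in type \<open>B_n\<close> accounts for
  the value 2 below.
\<close>

definition chain_len :: "affine_type \<Rightarrow> nat \<Rightarrow> nat" where
  "chain_len ty n = (if ty = D_twisted then 2 * n else 2 * n - 1)"

definition chain_label :: "affine_type \<Rightarrow> nat \<Rightarrow> nat \<Rightarrow> nat" where
  "chain_label ty n k = (if k < n then Suc k else chain_len ty n - k)"

definition chain_eps :: "affine_type \<Rightarrow> nat \<Rightarrow> nat \<Rightarrow> nat \<Rightarrow> nat" where
  "chain_eps ty n k i =
    (if k > 0 \<and> chain_label ty n (k - 1) = i
     then if ty = D_twisted \<and> k = Suc n then 2 else 1 else 0)"

definition chain_phi :: "affine_type \<Rightarrow> nat \<Rightarrow> nat \<Rightarrow> nat \<Rightarrow> nat" where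
  "chain_phi ty n k i =
    (if k < chain_len ty n \<and> chain_label ty n k = i
     then if ty = D_twisted \<and> Suc k = n then 2 else 1 else 0)"

lemma chain_label_range: "n \<ge> 2 \<Longrightarrow> k < chain_len ty n \<Longrightarrow> chain_label ty n k \<in> {1..n}"
  by (auto simp: chain_label_def chain_len_def split: if_splits)

text \<open>Equal consecutive labels are the only source of strings of length 2, and later of the
  exceptional pair in \<open>rel\<close>.\<close>

lemma chain_label_repeat:
  assumes "n \<ge> 2" "Suc k < chain_len ty n"
  shows "chain_label ty n (Suc k) = chain_label ty n k \<longleftrightarrow> Suc k = n \<and> ty = D_twisted"
  using assms by (auto simp: chain_label_def chain_len_def split: if_splits)

lemma chain_eps_Suc:
  assumes "n \<ge> 2" "k < chain_len ty n"
  shows "chain_eps ty n (Suc k) i = (if chain_label ty n k = i then Suc (chain_eps ty n k i) else 0)"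
  using assms chain_label_repeat[of n "k - 1" ty]
  by (cases k) (auto simp: chain_eps_def)

lemma chain_phi_pos: "chain_phi ty n k i > 0 \<longleftrightarrow> k < chain_len ty n \<and> chain_label ty n k = i"
  by (auto simp: chain_phi_def)

lemma chain_phi_Suc:
  assumes "n \<ge> 2" "k < chain_len ty n"
  shows "chain_phi ty n k i = (if chain_label ty n k = i then Suc (chain_phi ty n (Suc k) i) else 0)"
  using assms chain_label_repeat[of n k ty]
  by (auto simp: chain_phi_def chain_len_def split: if_splits)

definition chain_wt :: "affine_type \<Rightarrow> nat \<Rightarrow> nat \<Rightarrow> weight" where
  "chain_wt ty n k = (\<lambda>i. int (chain_phi ty n k i) - int (chain_eps ty n k i))"

lemma chain_wt_0: "n \<ge> 2 \<Longrightarrow> chain_wt ty n 0 i = fund 1 i"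
  by (auto simp: chain_wt_def chain_eps_def chain_phi_def chain_label_def chain_len_def fund_def)

text \<open>At the label of the arrow the string position shifts by one, which gives the diagonal
  entry 2. At any other index only the two adjacent arrows of the chain can contribute, and they
  reproduce the rest of the Cartan column.\<close>

lemma chain_wt_Suc:
  assumes n: "n \<ge> 2" and k: "k < chain_len ty n" and i: "i \<in> {1..n}"
  shows "chain_wt ty n (Suc k) i = chain_wt ty n k i - cartan ty n i (chain_label ty n k)"
proof (cases "i = chain_label ty n k")
  case True
  then show ?thesis
    using chain_eps_Suc[OF n k, of i] chain_phi_Suc[OF n k, of i] by (simp add: chain_wt_def cartan_def)
next
  case False
  \<comment> \<open>Off the label, \<open>chain_phi\<close> vanishes at \<open>k\<close> and
    \<open>chain_eps\<close> at \<open>Suc k\<close>.\<close>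
  then have *: "chain_wt ty n (Suc k) i - chain_wt ty n k i
      = int (chain_phi ty n (Suc k) i) + int (chain_eps ty n k i)"
    using chain_eps_Suc[OF n k, of i] chain_phi_Suc[OF n k, of i] by (simp add: chain_wt_def)

  define m where "m = chain_len ty n"
  have m: "m = (if ty = D_twisted then 2 * n else 2 * n - 1)" by (simp add: m_def chain_len_def)
  have up: "chain_label ty n j = Suc j" if "j < n" for j using that by (simp add: chain_label_def)
  have down: "chain_label ty n j = m - j" if "j \<ge> n" for j using that by (simp add: chain_label_def m_def)
  have "int (chain_phi ty n (Suc k) i) + int (chain_eps ty n k i) = - cartan ty n i (chain_label ty n k)"
  proof -
    \<comment> \<open>Position of the arrow relative to the turn of the labels: rising branch, its
      last arrow (followed by n in type \<open>B_n\<close> and by n - 1 in type \<open>C_n\<close>),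
      first arrow after it, descending branch.\<close>
    consider "Suc k < n" | "Suc k = n" "ty = D_twisted" | "Suc k = n" "ty = A_twisted"
      | "k = n" | "k > n"
      by (cases ty) linarith+
    then show ?thesis
    proof cases
      case 1
      then have l: "chain_label ty n k = Suc k" "chain_label ty n (Suc k) = Suc (Suc k)" "Suc k < m"
        "k > 0 \<Longrightarrow> chain_label ty n (k - 1) = k"
        using m by (auto simp: up)
      have P: "chain_phi ty n (Suc k) i =
          (if i = Suc (Suc k) then if ty = D_twisted \<and> i = n then 2 else 1 else 0)"
        unfolding chain_phi_def l(2) m_def[symmetric] using l(3) by auto
      have E: "chain_eps ty n k i = (if i = k then 1 else 0)"
        unfolding chain_eps_def using l(4) 1 i by auto
      show ?thesis
        unfolding P E l(1) cartan_def using 1 i False[unfolded l(1)] by (cases ty) auto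
    next
      case 2
      have l: "chain_label ty n k = n" "chain_label ty n (Suc k) = n" "chain_label ty n (k - 1) = k"
        using up[of k] down[of "Suc k"] up[of "k - 1"] m n 2 by simp_all
      have P: "chain_phi ty n (Suc k) i = 0"
        unfolding chain_phi_def l(2) using False[unfolded l(1)] by auto
      have E: "chain_eps ty n k i = (if i = k then 1 else 0)"
        unfolding chain_eps_def l(3) using 2 n i by auto
      show ?thesis
        unfolding P E l(1) cartan_def using 2 i False[unfolded l(1)] by auto
    next
      case 3
      have l: "chain_label ty n k = n" "chain_label ty n (Suc k) = k" "chain_label ty n (k - 1) = k"
        "Suc k < m"
        using up[of k] down[of "Suc k"] up[of "k - 1"] m n 3 by simp_all
      have P: "chain_phi ty n (Suc k) i = (if i = k then 1 else 0)"
        unfolding chain_phi_def l(2) m_def[symmetric] using 3 l(4) by auto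
      have E: "chain_eps ty n k i = (if i = k then 1 else 0)"
        unfolding chain_eps_def l(3) using 3 n i by auto
      show ?thesis
        unfolding P E l(1) cartan_def using 3 i False[unfolded l(1)] by auto
    next
      case 4
      have l: "chain_label ty n k = m - n" "chain_label ty n (Suc k) = m - n - 1"
        "chain_label ty n (k - 1) = n" "m - n = (if ty = D_twisted then n else n - 1)"
        using 4 m n k m_def by (auto simp: up down)
      have P: "chain_phi ty n (Suc k) i = (if i = m - n - 1 then 1 else 0)"
        unfolding chain_phi_def l(2) m_def[symmetric] using 4 i by auto
      have E: "chain_eps ty n k i = (if i = n then 1 else 0)"
        unfolding chain_eps_def l(3) using 4 n i by auto
      show ?thesis
        unfolding P E l(1) cartan_def using n i False[unfolded l(1)] l(4)
        by (cases ty) auto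
    next
      case 5
      define j where "j = m - k"
      have j: "0 < j" "j < n" using 5 k m by (auto simp: j_def m_def)
      have l: "chain_label ty n k = j" "chain_label ty n (Suc k) = j - 1"
        "chain_label ty n (k - 1) = Suc j"
        using 5 k m by (auto simp: down j_def m_def)
      have P: "chain_phi ty n (Suc k) i = (if i = j - 1 then 1 else 0)"
        unfolding chain_phi_def l(2) m_def[symmetric] using 5 i j by (auto simp: j_def)
      have E: "chain_eps ty n k i = (if i = Suc j then if ty = D_twisted \<and> i = n then 2 else 1 else 0)"
        unfolding chain_eps_def l(3) using 5 n i j m by (auto simp: j_def)
      show ?thesis
        unfolding P E l(1) cartan_def using n j i False[unfolded l(1)] by (cases ty) auto
    qed
  qed
  then show ?thesis using * by simp
qed

lemma chain_wt_last:
  assumes n: "n \<ge> 2"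
  shows "chain_wt ty n (chain_len ty n) i = - fund 1 i"
proof -
  have "chain_label ty n (chain_len ty n - Suc 0) = 1" "chain_len ty n > 0"
    "ty = D_twisted \<Longrightarrow> chain_len ty n \<noteq> Suc n"
    using n by (auto simp: chain_label_def chain_len_def)
  then show ?thesis
    by (auto simp: chain_wt_def chain_eps_def chain_phi_def fund_def)
qed

text \<open>
  The coefficients are those of a multiple of the sum of the positive coroots, so that all simple roots
  have the same positive height.  This rules out cycles of arrows.
\<close>

definition height_coeff :: "affine_type \<Rightarrow> nat \<Rightarrow> nat \<Rightarrow> int" where
  "height_coeff ty n i =
    int i * (int (chain_len ty n) + 1 - int i) * (if ty = D_twisted \<and> i = n then 1 else 2)"

definition height :: "affine_type \<Rightarrow> nat \<Rightarrow> weight \<Rightarrow> int" where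
  "height ty n w = (\<Sum>i=1..n. height_coeff ty n i * w i)"

text \<open>Only \<open>j\<close> and its neighbours contribute, and minus the second difference of
  \<open>2 * i * (m + 1 - i)\<close> is 4, where m is \<open>chain_len ty n\<close>. In type
  \<open>B_n\<close> the halved coefficient at \<open>n\<close> offsets the entry -2 in row
  \<open>n\<close>; at \<open>j = n\<close> the value of m enters.\<close>

lemma height_root:
  assumes n: "n \<ge> 2" and j: "j \<in> {1..n}"
  shows "height ty n (\<lambda>i. cartan ty n i j) = 4"
proof -
  let ?g = "\<lambda>i. height_coeff ty n i * cartan ty n i j"
  have m: "int (chain_len ty n) = (if ty = D_twisted then 2 * int n else 2 * int n - 1)"
    using n by (auto simp: chain_len_def)
  have sub: "(\<Sum>i=1..n. ?g i) = sum ?g T"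
    if "T \<subseteq> {1..n}" "\<And>i. i \<in> {1..n} - T \<Longrightarrow> i \<noteq> j \<and> i \<noteq> Suc j \<and> j \<noteq> Suc i" for T
  proof (rule sum.mono_neutral_right)
    show "\<forall>i\<in>{1..n} - T. ?g i = 0"
      using that(2) by (intro ballI) (auto simp: cartan_def)
  qed (use that(1) in auto)
  let ?M = "int (chain_len ty n)"
  consider "j = 1" | "1 < j" "j < n" | "1 < j" "j = n" using j by force
  then show ?thesis
  proof cases
    case 1
    have "height ty n (\<lambda>i. cartan ty n i j) = ?g 1 + ?g 2"
      unfolding height_def using 1 n by (subst sub[of "{1, 2}"]) auto
    moreover have "?g 1 = 4 * ?M"
      using n 1 by (simp add: height_coeff_def cartan_def)
    moreover have "?g 2 = - 4 * (?M - 1)"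
      using n 1 by (simp add: height_coeff_def cartan_def)
    ultimately show ?thesis by simp
  next
    case 2
    then obtain k where k: "j = Suc k" "k \<ge> 1" by (cases j) auto
    have "height ty n (\<lambda>i. cartan ty n i j) = ?g k + ?g j + ?g (Suc j)"
      unfolding height_def using 2 k n by (subst sub[of "{k, j, Suc j}"]) auto
    moreover have "?g k = - 2 * (int k * (?M + 1 - int k))"
      using n 2 k by (simp add: height_coeff_def cartan_def)
    moreover have "?g j = 4 * ((int k + 1) * (?M - int k))"
      using n 2 k by (simp add: height_coeff_def cartan_def)
    moreover have "?g (Suc j) = - 2 * ((int k + 2) * (?M - int k - 1))"
      using n 2 k by (simp add: height_coeff_def cartan_def)
    ultimately show ?thesis by (simp add: algebra_simps)
  next
    case 3
    then obtain k where k: "j = Suc k" "n = Suc k" "k \<ge> 1" by (cases j) auto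
    have "height ty n (\<lambda>i. cartan ty n i j) = ?g k + ?g n"
      unfolding height_def using 3 k n by (subst sub[of "{k, n}"]) auto
    moreover have "?g k = (if ty = D_twisted then - 2 else - 4) * (int k * (?M + 1 - int k))"
      using k by (cases ty) (simp_all add: height_coeff_def cartan_def)
    moreover have "?g n = (if ty = D_twisted then 2 else 4) * ((int k + 1) * (?M - int k))"
      using k by (cases ty) (simp_all add: height_coeff_def cartan_def)
    moreover have "?M = (if ty = D_twisted then 2 * int k + 2 else 2 * int k + 1)"
      using k by (simp add: chain_len_def)
    ultimately show ?thesis by (cases ty) (simp_all add: algebra_simps)
  qed
qed

lemma height_diff: "height ty n (\<lambda>i. v i - w i) = height ty n v - height ty n w"
  by (simp add: height_def right_diff_distrib sum_subtractf)

lemma height_cong: "(\<And>i. i \<in> {1..n} \<Longrightarrow> v i = w i) \<Longrightarrow> height ty n v = height ty n w"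
  unfolding height_def by (intro sum.cong) auto

lemma height_fund_1:
  assumes "n \<ge> 2" shows "height ty n (fund 1) = 2 * int (chain_len ty n)"
proof -
  have "height ty n (fund 1) = (\<Sum>i=1..n. if i = 1 then height_coeff ty n i else 0)"
    unfolding height_def fund_def by (intro sum.cong) auto
  also have "\<dots> = height_coeff ty n 1" using assms by (simp add: sum.delta)
  finally show ?thesis using assms by (simp add: height_coeff_def)
qed

lemma height_zero: "height ty n (\<lambda>i. 0) = 0"
  by (simp add: height_def)

lemma height_chain_wt:
  assumes "n \<ge> 2" "k \<le> chain_len ty n"
  shows "height ty n (chain_wt ty n k) = 2 * int (chain_len ty n) - 4 * int k"
  using assms(2)
proof (induction k)
  case 0
  have "height ty n (chain_wt ty n 0) = height ty n (fund 1)"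
    using chain_wt_0[OF assms(1)] by (intro height_cong) auto
  then show ?case using height_fund_1[OF assms(1)] by simp
next
  case (Suc k)
  have "height ty n (chain_wt ty n (Suc k))
      = height ty n (\<lambda>i. chain_wt ty n k i - cartan ty n i (chain_label ty n k))"
    using chain_wt_Suc[OF assms(1)] Suc by (intro height_cong) auto
  then show ?case
    using Suc height_root[OF assms(1) chain_label_range[OF assms(1)]] by (simp add: height_diff)
qed

text \<open>Starting from u, follow the predicted labels. The weight and the arrows into
  \<open>c k\<close> determine the arrows out of it; that no unexpected arrow enters
  \<open>c k\<close> follows from the height together with reachability from u.\<close>

lemma hw_chain:
  assumes n: "n \<ge> 2" and gen: "generated_by_hw (cartan ty n) {1..n} (fund 1) C u"
  shows "\<exists>c. elts C = c ` {..chain_len ty n} \<and> inj_on c {..chain_len ty n} \<and>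
    (\<forall>k\<le>chain_len ty n. \<forall>i\<in>{1..n}.
       eop C i (c k) = (if k > 0 \<and> chain_label ty n (k - 1) = i then Some (c (k - 1)) else None) \<and>
       fop C i (c k) = (if k < chain_len ty n \<and> chain_label ty n k = i then Some (c (Suc k)) else None) \<and>
       wt C (c k) i = chain_wt ty n k i)"
proof -
  let ?J = "{1..n}"
  let ?lab = "chain_label ty n"
  define m where "m = chain_len ty n"
  have cr: "is_crystal (cartan ty n) ?J C" and u: "u \<in> elts C"
    and eu: "\<And>i. i \<in> ?J \<Longrightarrow> eop C i u = None" and wu: "\<And>i. i \<in> ?J \<Longrightarrow> wt C u i = fund 1 i"
    and reach: "\<And>b. b \<in> elts C \<Longrightarrow> (u, b) \<in> (arrows ?J C)\<^sup>*"
    using gen by (auto simp: generated_by_hw_def)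
  \<comment> \<open>Past \<open>m\<close> these values are unspecified; all claims about
    \<open>c\<close> stop at \<open>m\<close>.\<close>
  define c where "c = rec_nat u (\<lambda>k b. the (fop C (?lab k) b))"
  have c0: "c 0 = u" and cS: "c (Suc k) = the (fop C (?lab k) (c k))" for k
    by (simp_all add: c_def)
  define ht where "ht b = height ty n (wt C b)" for b
  have ht_arrow: "ht b' = ht b - 4" if "i \<in> ?J" "b \<in> elts C" "fop C i b = Some b'" for i b b'
  proof -
    have "ht b' = height ty n (\<lambda>j. wt C b j - cartan ty n j i)"
      unfolding ht_def using crystal_wt[OF cr that(1) _ that(2,3)] by (intro height_cong) auto
    then show ?thesis using height_root[OF n that(1)] by (simp add: height_diff ht_def)
  qed
  have ht_reach: "ht b' \<le> ht b" if "(b, b') \<in> (arrows ?J C)\<^sup>*" for b b'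
    using that
  proof (induction rule: rtrancl_induct)
    case (step y z)
    then obtain i where "i \<in> ?J" "y \<in> elts C" "fop C i y = Some z" by (auto simp: arrows_def)
    then show ?case using ht_arrow step.IH by fastforce
  qed simp
  define Q where "Q k \<longleftrightarrow> c k \<in> elts C \<and> (\<forall>i\<in>?J. wt C (c k) i = chain_wt ty n k i \<and>
    eop C i (c k) = (if k > 0 \<and> ?lab (k - 1) = i then Some (c (k - 1)) else None) \<and>
    eps C i (c k) = chain_eps ty n k i)" for k
  \<comment> \<open>As \<open>phi\<close> is the weight plus \<open>eps\<close>, the data in
    \<open>Q k\<close> decide which arrows leave \<open>c k\<close>.\<close>
  have fopQ: "fop C i (c k) = (if k < m \<and> ?lab k = i then Some (c (Suc k)) else None)"
    if "Q k" "i \<in> ?J" for k i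
  proof -
    have p: "phi C i (c k) = chain_phi ty n k i"
      using that unfolding Q_def wt_def chain_wt_def by fastforce
    show ?thesis
    proof (cases "fop C i (c k)")
      case None
      then have "phi C i (c k) = 0" by (rule phi_None)
      then show ?thesis using None p chain_phi_pos[of ty n k i] by (auto simp: m_def)
    next
      case (Some b)
      then have "phi C i (c k) > 0"
        using phi_Some[OF cr that(2)] that(1) by (simp add: Q_def)
      then show ?thesis using Some p chain_phi_pos[of ty n k i] by (auto simp: m_def cS)
    qed
  qed
  have htQ: "ht (c k) = 2 * int m - 4 * int k" if "Q k" "k \<le> m" for k
  proof -
    have "ht (c k) = height ty n (chain_wt ty n k)"
      unfolding ht_def using that(1) by (intro height_cong) (auto simp: Q_def)
    then show ?thesis using height_chain_wt[OF n] that(2) by (simp add: m_def)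
  qed
  have Q: "Q k" if "k \<le> m" for k
    using that
  proof (induction k rule: less_induct)
    case (less k)
    show ?case
    proof (cases k)
      case 0
      then show ?thesis
        using u eu wu chain_wt_0[OF n] by (auto simp: Q_def c0 chain_eps_def eps_None)
    next
      case (Suc k')
      let ?l = "?lab k'"
      have IH: "Q j" if "j \<le> k'" for j using less that Suc by auto
      have k': "k' < m" using less Suc by auto
      have l: "?l \<in> ?J" using chain_label_range[OF n] k' by (simp add: m_def)
      have ck': "c k' \<in> elts C" using IH[of k'] by (simp add: Q_def)
      have f: "fop C ?l (c k') = Some (c k)" using fopQ[OF IH l, of k'] k' Suc by simp
      have ck: "c k \<in> elts C" using crystal_ops_closed(2)[OF cr l ck' f] .
      have wtk: "wt C (c k) i = chain_wt ty n k i" if "i \<in> ?J" for i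
        using crystal_wt[OF cr l that ck' f] chain_wt_Suc[OF n _ that, of k' ty] k' IH[of k'] that Suc
        by (simp add: m_def Q_def)
      have htk: "ht (c k) = 2 * int m - 4 * int k"
        using ht_arrow[OF l ck' f] htQ[OF IH, of k'] k' Suc by simp
      \<comment> \<open>The arrows out of the earlier chain elements are all known, so a path from u
        can leave these elements only through \<open>c k\<close>.\<close>
      have below: "(\<exists>j\<le>k'. b = c j) \<or> (c k, b) \<in> (arrows ?J C)\<^sup>*" if "(u, b) \<in> (arrows ?J C)\<^sup>*" for b
        using that
      proof (induction rule: rtrancl_induct)
        case base
        then show ?case using c0 by (intro disjI1) auto
      next
        case (step y z)
        show ?case
        proof (cases "\<exists>j\<le>k'. y = c j")
          case True
          then obtain j i where "j \<le> k'" "y = c j" "i \<in> ?J" "fop C i (c j) = Some z"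
            using step(2) by (auto simp: arrows_def)
          then have "z = c (Suc j)" using fopQ[OF IH] by (auto split: if_splits)
          then show ?thesis
            using \<open>j \<le> k'\<close> Suc by (cases "j = k'") (auto intro!: disjI1 exI[of _ "Suc j"])
        next
          case False
          then show ?thesis using step by (meson rtrancl.rtrancl_into_rtrancl)
        qed
      qed
      have ek: "eop C i (c k) = (if ?l = i then Some (c k') else None)" if i: "i \<in> ?J" for i
      proof (cases "?l = i")
        case True
        then show ?thesis using crystal_eop_fop(1)[OF cr l ck' f] by simp
      next
        case False
        have "eop C i (c k) \<noteq> Some b" for b
        proof
          assume e: "eop C i (c k) = Some b"
          have b: "b \<in> elts C" "fop C i b = Some (c k)"
            using crystal_ops_closed(1)[OF cr i ck e] crystal_eop_fop(2)[OF cr i ck e] by auto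
          \<comment> \<open>The source \<open>b\<close> is 4 higher than \<open>c k\<close>. Among
            the earlier chain elements only \<open>c k'\<close> has that height, and nothing
            reachable from \<open>c k\<close> does.\<close>
          from below[OF reach[OF b(1)]] show False
          proof
            assume "\<exists>j\<le>k'. b = c j"
            then obtain j where j: "j \<le> k'" "b = c j" by blast
            have "?lab j = i" using b(2) fopQ[OF IH[OF j(1)] i] j by (auto split: if_splits)
            moreover have "j = k'"
              using ht_arrow[OF i b] htQ[OF IH[OF j(1)]] htk j k' Suc by simp
            ultimately show False using False by simp
          next
            assume "(c k, b) \<in> (arrows ?J C)\<^sup>*"
            then show False using ht_reach[of "c k" b] ht_arrow[OF i b] by simp
          qed
        qed
        then show ?thesis using False by (cases "eop C i (c k)") auto
      qed
      have "eps C i (c k) = chain_eps ty n k i" if i: "i \<in> ?J" for i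
        using eps_Some[OF cr i ck, of "c k'"] eps_None[of C i "c k"] ek[OF i] IH[of k'] i
          chain_eps_Suc[OF n, of k' ty i] k' Suc
        by (auto simp: Q_def m_def)
      then show ?thesis using ck wtk ek Suc by (simp add: Q_def)
    qed
  qed
  have "b \<in> c ` {..m}" if "(u, b) \<in> (arrows ?J C)\<^sup>*" for b
    using that
  proof (induction rule: rtrancl_induct)
    case base
    then show ?case using c0 by (intro image_eqI[of _ _ 0]) auto
  next
    case (step y z)
    then obtain k i where "k \<le> m" "y = c k" "i \<in> ?J" "fop C i (c k) = Some z"
      by (auto simp: arrows_def)
    then have "z = c (Suc k)" "Suc k \<le> m" using fopQ[OF Q] by (auto split: if_splits)
    then show ?case by blast
  qed
  then have "elts C = c ` {..m}" using reach Q by (auto simp: Q_def)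
  moreover have "inj_on c {..m}"
  proof (rule inj_onI)
    fix x y assume "x \<in> {..m}" "y \<in> {..m}" and eq: "c x = c y"
    then have "x \<le> m" "y \<le> m" by simp_all
    then have "ht (c x) = 2 * int m - 4 * int x" "ht (c y) = 2 * int m - 4 * int y"
      using htQ Q by blast+
    then show "x = y" unfolding eq by linarith
  qed
  moreover have "\<forall>k\<le>m. \<forall>i\<in>?J.
       eop C i (c k) = (if k > 0 \<and> ?lab (k - 1) = i then Some (c (k - 1)) else None) \<and>
       fop C i (c k) = (if k < m \<and> ?lab k = i then Some (c (Suc k)) else None) \<and>
       wt C (c k) i = chain_wt ty n k i"
  proof (intro allI impI ballI)
    fix k i assume "k \<le> m" "i \<in> ?J"
    then show "eop C i (c k) = (if k > 0 \<and> ?lab (k - 1) = i then Some (c (k - 1)) else None) \<and>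
       fop C i (c k) = (if k < m \<and> ?lab k = i then Some (c (Suc k)) else None) \<and>
       wt C (c k) i = chain_wt ty n k i"
      using Q[of k, unfolded Q_def] fopQ[OF Q, of k i] by simp
  qed
  ultimately show ?thesis
    unfolding m_def by (intro exI[of _ c] conjI)
qed

section \<open>The Kirillov-Reshetikhin crystal in chain indices\<close>

locale kr_chain =
  fixes ty :: affine_type and n :: nat and B :: "'a crystal" and X :: "'a set" and z :: 'a
    and c :: "nat \<Rightarrow> 'a"
  assumes n: "n \<ge> 2" and KR: "is_KR11 ty n B X z"
    and X_eq: "X = c ` {..chain_len ty n}" and inj: "inj_on c {..chain_len ty n}"
    and eop_chain: "\<And>k i. k \<le> chain_len ty n \<Longrightarrow> i \<in> {1..n} \<Longrightarrow>
      eop B i (c k) = (if k > 0 \<and> chain_label ty n (k - 1) = i then Some (c (k - 1)) else None)"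
    and fop_chain: "\<And>k i. k \<le> chain_len ty n \<Longrightarrow> i \<in> {1..n} \<Longrightarrow>
      fop B i (c k) = (if k < chain_len ty n \<and> chain_label ty n k = i then Some (c (Suc k)) else None)"
    and wt_chain: "\<And>k i. k \<le> chain_len ty n \<Longrightarrow> i \<in> {1..n} \<Longrightarrow> wt B (c k) i = chain_wt ty n k i"

lemma is_KR11_chain:
  assumes "n \<ge> 2" "is_KR11 ty n B X z"
  shows "\<exists>c. kr_chain ty n B X z c"
proof -
  have "dominant {1..n} (fund 1)" using assms(1) by (auto simp: dominant_def fund_def)
  then obtain u where "generated_by_hw (cartan ty n) {1..n} (fund 1) (subcrystal X B) u"
    using assms(2) is_hw_crystal_generated unfolding is_KR11_def by blast
  from hw_chain[OF assms(1) this] show ?thesis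
    using assms unfolding kr_chain_def subcrystal_simps by blast
qed

context kr_chain
begin

abbreviation "m \<equiv> chain_len ty n"
abbreviation "lab \<equiv> chain_label ty n"

lemma m_ge: "m \<ge> 3" and m_pos: "0 < m" and m_ge_n: "n < m"
  using n by (auto simp: chain_len_def)

lemma crystal: "is_crystal (cartan ty n) {0..n} B"
  and connected: "connected_crystal {0..n} B"
  and elts_B: "elts B = c ` {..m} \<union> {z}"
  and z_notin: "z \<notin> c ` {..m}"
  using KR unfolding is_KR11_def X_eq by auto

lemma c_in: "k \<le> m \<Longrightarrow> c k \<in> elts B" and z_in: "z \<in> elts B"
  by (auto simp: elts_B)

lemma c_neq_z: "k \<le> m \<Longrightarrow> c k \<noteq> z" "k \<le> m \<Longrightarrow> z \<noteq> c k"
  using z_notin by auto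

lemma c_eq_iff: "a \<le> m \<Longrightarrow> b \<le> m \<Longrightarrow> c a = c b \<longleftrightarrow> a = b"
  using inj by (auto simp: inj_on_def)

lemma elts_cases:
  assumes "x \<in> elts B"
  obtains "x = z" | k where "k \<le> m" "x = c k"
  using assms by (auto simp: elts_B)

text \<open>An arrow inside a one-element crystal would be a loop, but \<open>eps\<close> and
  \<open>phi\<close> change by one along an arrow.\<close>

lemma z_ops:
  assumes i: "i \<in> {1..n}"
  shows "eop B i z = None" "fop B i z = None"
proof -
  have cr: "is_crystal (cartan ty n) {1..n} (subcrystal {z} B)"
    using KR unfolding is_KR11_def is_hw_crystal_def by blast
  have z: "z \<in> elts (subcrystal {z} B)" by simp
  show "eop B i z = None"
  proof (cases "eop B i z")
    case (Some b)
    then show ?thesis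
      using crystal_ops_closed(1)[OF cr i z] eps_Some[OF cr i z] by simp
  qed
  show "fop B i z = None"
  proof (cases "fop B i z")
    case (Some b)
    then show ?thesis
      using crystal_ops_closed(2)[OF cr i z] phi_Some[OF cr i z] by simp
  qed
qed

lemma z_eps_phi:
  assumes "i \<in> {1..n}" shows "eps B i z = 0" "phi B i z = 0"
  using eps_None phi_None z_ops[OF assms] by metis+

lemma eps_chain:
  assumes i: "i \<in> {1..n}" and "k \<le> m"
  shows "eps B i (c k) = chain_eps ty n k i"
  using assms(2)
proof (induction k)
  case 0
  then show ?case using eop_chain[OF _ i, of 0] eps_None[of B i "c 0"] by (simp add: chain_eps_def)
next
  case (Suc k)
  have J: "i \<in> {0..n}" using i by simp
  show ?case
  proof (cases "lab k = i")
    case True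
    then have "eop B i (c (Suc k)) = Some (c k)" using eop_chain[OF Suc.prems i] by simp
    then show ?thesis
      using eps_Some[OF crystal J c_in[OF Suc.prems]] Suc chain_eps_Suc[OF n, of k ty i] True by simp
  next
    case False
    then have "eop B i (c (Suc k)) = None" using eop_chain[OF Suc.prems i] by simp
    then show ?thesis
      using eps_None[of B i] Suc chain_eps_Suc[OF n, of k ty i] False by simp
  qed
qed

lemma phi_chain:
  assumes i: "i \<in> {1..n}" and k: "k \<le> m"
  shows "phi B i (c k) = chain_phi ty n k i"
  using wt_chain[OF k i] eps_chain[OF i k] by (simp add: wt_def chain_wt_def)

subsection \<open>The 0-arrows\<close>

definition ht :: "'a \<Rightarrow> int" where "ht b = height ty n (wt B b)"

lemma ht_c:
  assumes "k \<le> m" shows "ht (c k) = 2 * int m - 4 * int k"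
proof -
  have "ht (c k) = height ty n (chain_wt ty n k)"
    unfolding ht_def using wt_chain[OF assms] by (rule height_cong)
  then show ?thesis using height_chain_wt[OF n assms] by simp
qed

lemma ht_z: "ht z = 0"
proof -
  have "ht z = height ty n (\<lambda>_. 0)"
    unfolding ht_def by (rule height_cong) (simp add: wt_def z_eps_phi)
  then show ?thesis by (simp add: height_zero)
qed

text \<open>The classical part of \<alpha>_0 is minus the first fundamental weight, which has height
  2m.\<close>

lemma fop_0_wt:
  assumes "b \<in> elts B" "fop B 0 b = Some b'"
  shows "wt B b' 1 = wt B b 1 + 1" "ht b' = ht b + 2 * int m"
proof -
  have w: "wt B b' i = wt B b i - (- fund 1 i)" if "i \<in> {1..n}" for i
  proof -
    have "cartan ty n i 0 = - fund 1 i"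
      using n that by (auto simp: cartan_def fund_def)
    then show ?thesis using crystal_wt[OF crystal _ _ assms, of i] that by simp
  qed
  show "wt B b' 1 = wt B b 1 + 1" using w[of 1] n by (simp add: fund_def)
  have "ht b' = height ty n (\<lambda>i. wt B b i - (- fund 1 i))"
    unfolding ht_def using w by (rule height_cong)
  also have "\<dots> = ht b - height ty n (\<lambda>i. - fund 1 i)"
    by (simp only: height_diff ht_def)
  also have "height ty n (\<lambda>i. - fund 1 i) = - height ty n (fund 1)"
    by (simp add: height_def sum_negf)
  finally show "ht b' = ht b + 2 * int m" using height_fund_1[OF n] by simp
qed

text \<open>A 0-arrow climbs 2m within heights from -2m to 2m. This fixes the arrows at
  \<open>z\<close>; between chain elements it gives \<open>2 * a = 2 * b + m\<close>, and the last
  two cases are the ones in which an end of the chain is involved.\<close>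

lemma fop_0_cases:
  assumes x: "x \<in> elts B" and f: "fop B 0 x = Some y"
  obtains "x = c m" "y = z" | "x = z" "y = c 0"
    | a where "x = c a" "y = c 0" "2 * a = m"
    | b where "x = c m" "y = c b" "2 * b = m"
proof -
  have y: "y \<in> elts B" using crystal_ops_closed(2)[OF crystal _ x f] by simp
  note ht = fop_0_wt(2)[OF x f]
  from x show thesis
  proof (cases rule: elts_cases)
    case 1
    from y show thesis
    proof (cases rule: elts_cases)
      case 1
      then show thesis using ht \<open>x = z\<close> m_pos by simp
    next
      case (2 k)
      then have "k = 0" using ht ht_c[of k] ht_z \<open>x = z\<close> by simp
      then show thesis using that(2) 2 \<open>x = z\<close> by simp
    qed
  next
    case (2 a)
    from y show thesis
    proof (cases rule: elts_cases)
      case 1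
      then have "a = m" using ht ht_c[of a] ht_z 2 by simp
      then show thesis using that(1) 1 2 by simp
    next
      case (2 b)
      have ab: "2 * a = 2 * b + m"
        using ht ht_c[OF \<open>a \<le> m\<close>] ht_c[OF \<open>b \<le> m\<close>] unfolding \<open>x = c a\<close> \<open>y = c b\<close> by linarith
      consider "b = 0" | "a = m" | "0 < b" "a < m" using \<open>a \<le> m\<close> by linarith
      then show thesis
      proof cases
        case 1
        then show thesis using that(3)[of a] ab \<open>x = c a\<close> 2 by simp
      next
        case 2
        then show thesis using that(4)[of b] ab \<open>x = c a\<close> \<open>y = c b\<close> by simp
      next
        case 3
        \<comment> \<open>In type \<open>A_{2n}^{(2)}\<close> the number m is odd, so two chain
          elements never differ by m/2 steps.\<close>
        have D: "m = 2 * n"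
        proof (cases ty)
          case A_twisted
          then have "m = 2 * n - 1" by (simp add: chain_len_def)
          then show ?thesis using ab n by presburger
        qed (simp add: chain_len_def)
        then have a: "a = b + n" using ab by simp
        \<comment> \<open>The coordinate at 1 excludes inner ends: it is nonnegative at
          \<open>c a\<close>, hence positive at \<open>c b\<close>, but on the rising branch only
          \<open>c 0\<close> has an outgoing arrow 1.\<close>
        have "lab (a - 1) \<noteq> 1" using a 3 D by (auto simp: chain_label_def)
        then have "chain_wt ty n a 1 \<ge> 0" by (simp add: chain_wt_def chain_eps_def)
        moreover have "chain_wt ty n b 1 = chain_wt ty n a 1 + 1"
          using fop_0_wt(1)[OF x f] wt_chain[of a 1] wt_chain[of b 1] n \<open>a \<le> m\<close> \<open>x = c a\<close> 2 by simp
        ultimately have "chain_phi ty n b 1 > 0" by (simp add: chain_wt_def)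
        then have "lab b = 1" by (simp add: chain_phi_pos)
        then show thesis using a 3 D by (simp add: chain_label_def)
      qed
    qed
  qed
qed

text \<open>None of the possible ends of a 0-arrow is \<open>c 1\<close>, because
  \<open>m \<ge> 3\<close>. So its weight at 0 is 0, which anchors the weights at 0 along the
  chain.\<close>

lemma c1_no_0: "fop B 0 (c 1) = None" "eop B 0 (c 1) = None"
proof -
  have c1: "c 1 \<in> elts B" using c_in m_ge by simp
  have neq: "c 1 \<noteq> c m" "c 1 \<noteq> z" "c 1 \<noteq> c 0" "2 * b = m \<Longrightarrow> c 1 \<noteq> c b" for b
    using c_eq_iff[of 1 m] c_neq_z(1)[of 1] c_eq_iff[of 1 0] c_eq_iff[of 1 b] m_ge by auto
  show "fop B 0 (c 1) = None"
  proof (cases "fop B 0 (c 1)")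
    case (Some y)
    from fop_0_cases[OF c1 this] show ?thesis using neq by metis
  qed
  show "eop B 0 (c 1) = None"
  proof (cases "eop B 0 (c 1)")
    case (Some x)
    then have "x \<in> elts B" "fop B 0 x = Some (c 1)"
      using crystal_ops_closed(1)[OF crystal _ c1] crystal_eop_fop(2)[OF crystal _ c1] by auto
    from fop_0_cases[OF this] show ?thesis using neq by metis
  qed
qed

text \<open>The entry -2 of the Cartan matrix at (0, 1) puts the weight of u at 0 two below that of
  \<open>c 1\<close>.\<close>

lemma eps_0_c0: "eps B 0 (c 0) \<ge> 2"
proof -
  have "fop B 1 (c 0) = Some (c 1)"
    using fop_chain[of 0 1] n m_pos by (simp add: chain_label_def)
  then have "wt B (c 1) 0 = wt B (c 0) 0 + 2"
    using crystal_wt[OF crystal _ _ c_in, of 1 0 0] n by (simp add: cartan_def)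
  moreover have "wt B (c 1) 0 = 0"
    using c1_no_0 by (simp add: wt_def eps_None phi_None)
  ultimately show ?thesis by (simp add: wt_def)
qed

text \<open>This is where connectedness enters: \<open>z\<close> has no classical arrows, so without
  0-arrows it would form a component of its own.\<close>

lemma z_not_isolated: "fop B 0 z \<noteq> None \<or> eop B 0 z \<noteq> None"
proof (rule ccontr)
  assume "\<not> ?thesis"
  then have no: "fop B i z = None" "eop B i z = None" if "i \<in> {0..n}" for i
    using z_ops[of i] that by (cases "i = 0", auto)+
  have "b = z" if "(z, b) \<in> (arrows {0..n} B \<union> (arrows {0..n} B)\<inverse>)\<^sup>*" for b
    using that
  proof (induction rule: rtrancl_induct)
    case (step y b)
    have "(z, b) \<notin> arrows {0..n} B" using no by (auto simp: arrows_def)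
    moreover have "(b, z) \<notin> arrows {0..n} B"
    proof
      assume "(b, z) \<in> arrows {0..n} B"
      then obtain i where "i \<in> {0..n}" "b \<in> elts B" "fop B i b = Some z" by (auto simp: arrows_def)
      then show False using crystal_eop_fop(1)[OF crystal] no by fastforce
    qed
    ultimately show ?case using step by auto
  qed simp
  then show False
    using connected c_in[of 0] c_neq_z(1)[of 0] z_in unfolding connected_crystal_def by blast
qed

text \<open>Since \<open>eps B 0 (c 0) \<ge> 2\<close>, there are 0-arrows t -> w -> u, and the task
  is to show that w is \<open>z\<close>.\<close>

lemma eop_0_c0: "eop B 0 (c 0) = Some z"
  and eop_0_z: "eop B 0 z = Some (c m)"
proof -
  have J: "0 \<in> {0..n}" by simp
  have c0: "c 0 \<in> elts B" using c_in by simp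
  obtain w where w: "eop B 0 (c 0) = Some w"
    using eps_0_c0 eps_None[of B 0 "c 0"] by fastforce
  have wB: "w \<in> elts B" and fw: "fop B 0 w = Some (c 0)"
    using crystal_ops_closed(1)[OF crystal J c0 w] crystal_eop_fop(2)[OF crystal J c0 w] by auto
  have "eps B 0 w > 0" using eps_Some[OF crystal J c0 w] eps_0_c0 by simp
  then obtain t where t: "eop B 0 w = Some t"
    using eps_None[of B 0 w] by fastforce
  have tB: "t \<in> elts B" and ft: "fop B 0 t = Some w"
    using crystal_ops_closed(1)[OF crystal J wB t] crystal_eop_fop(2)[OF crystal J wB t] by auto
  have wz: "w = z"
  proof (rule ccontr)
    \<comment> \<open>Then w is the chain element of weight 0 and t is v. The only possible partners
      of \<open>z\<close> are u and v, whose 0-arrows are already taken, so \<open>z\<close> would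
      be isolated.\<close>
    assume "w \<noteq> z"
    obtain a where a: "w = c a" "2 * a = m"
      using fop_0_cases[OF wB fw] \<open>w \<noteq> z\<close> c_neq_z(1)[of 0] c_eq_iff[of 0] m_pos
      by (metis le_add1 le_add_same_cancel1 mult_2 zero_le mult_0_right less_irrefl)
    have am: "a \<le> m" "a \<noteq> 0" using a m_pos by auto
    have "t = c m"
      using fop_0_cases[OF tB ft] \<open>w \<noteq> z\<close> c_eq_iff[of a 0] am a(1) by (metis zero_le)
    have "fop B 0 z = None"
    proof (cases "fop B 0 z")
      case (Some y)
      have "y = c 0"
        using fop_0_cases[OF z_in Some] c_neq_z(2)[of m] c_neq_z(2) by (metis le_refl le_add1 mult_2)
      then have "eop B 0 (c 0) = Some z" using crystal_eop_fop(1)[OF crystal J z_in Some] by simp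
      then show ?thesis using w \<open>w \<noteq> z\<close> by simp
    qed
    moreover have "eop B 0 z = None"
    proof (cases "eop B 0 z")
      case (Some x)
      have x: "x \<in> elts B" "fop B 0 x = Some z"
        using crystal_ops_closed(1)[OF crystal J z_in Some] crystal_eop_fop(2)[OF crystal J z_in Some] by auto
      have "x = c m"
        using fop_0_cases[OF x] c_neq_z(2)[of 0] by (metis zero_le)
      then show ?thesis using x(2) ft \<open>t = c m\<close> \<open>w \<noteq> z\<close> by simp
    qed
    ultimately show False using z_not_isolated by simp
  qed
  then show "eop B 0 (c 0) = Some z" using w by simp
  have "t = c m"
    using fop_0_cases[OF tB ft] wz c_neq_z(2)[of 0] by (metis zero_le)
  then show "eop B 0 z = Some (c m)" using t wz by simp
qed

lemma fop_0_z: "fop B 0 z = Some (c 0)"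
  and fop_0_cm: "fop B 0 (c m) = Some z"
  using crystal_eop_fop(2)[OF crystal _ c_in eop_0_c0] crystal_eop_fop(2)[OF crystal _ z_in eop_0_z]
  by auto

lemma fop_0_c:
  assumes "k < m" shows "fop B 0 (c k) = None"
proof (cases "fop B 0 (c k)")
  case (Some y)
  have k: "c k \<in> elts B" using assms c_in by simp
  from fop_0_cases[OF k Some] have "y = c 0"
    using assms c_eq_iff[of k m] c_neq_z(1)[of k] by (metis le_refl less_imp_le less_irrefl)
  then have "eop B 0 (c 0) = Some (c k)" using crystal_eop_fop(1)[OF crystal _ k Some] by simp
  then show ?thesis using eop_0_c0 c_neq_z(1)[of k] assms by simp
qed

lemma eop_0_c:
  assumes "0 < k" "k \<le> m" shows "eop B 0 (c k) = None"
proof (cases "eop B 0 (c k)")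
  case (Some x)
  have k: "c k \<in> elts B" using assms c_in by simp
  have x: "x \<in> elts B" "fop B 0 x = Some (c k)"
    using crystal_ops_closed(1)[OF crystal _ k Some] crystal_eop_fop(2)[OF crystal _ k Some] by auto
  from fop_0_cases[OF x] have "x = c m"
    using assms c_eq_iff[of k 0] c_neq_z(1)[of k] by (metis zero_le less_irrefl)
  then show ?thesis using x(2) fop_0_cm c_neq_z(1)[of k] assms by simp
qed

lemma eps_0: "eps B 0 (c 0) = 2" "eps B 0 z = 1" "0 < k \<Longrightarrow> k \<le> m \<Longrightarrow> eps B 0 (c k) = 0"
proof -
  show c: "eps B 0 (c k) = 0" if "0 < k" "k \<le> m" for k
    using eop_0_c[OF that] by (rule eps_None)
  show z: "eps B 0 z = 1"
    using eps_Some[OF crystal _ z_in eop_0_z] c[OF m_pos] by simp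
  show "eps B 0 (c 0) = 2"
    using eps_Some[OF crystal _ c_in eop_0_c0] z by simp
qed

lemma phi_0: "phi B 0 (c m) = 2" "phi B 0 z = 1" "k < m \<Longrightarrow> phi B 0 (c k) = 0"
proof -
  show c: "phi B 0 (c k) = 0" if "k < m" for k
    using fop_0_c[OF that] by (rule phi_None)
  show z: "phi B 0 z = 1"
    using phi_Some[OF crystal _ z_in fop_0_z] c[OF m_pos] by simp
  show "phi B 0 (c m) = 2"
    using phi_Some[OF crystal _ c_in fop_0_cm] z by simp
qed

text \<open>The extreme height 2m occurs only at \<open>c 0\<close>, so the description by weight is
  unique; v is treated in the same way with -2m.\<close>

lemma u_elt_eq: "u_elt n B = c 0"
  unfolding u_elt_def elt_of_wt_def
proof (rule the_equality)
  show "c 0 \<in> elts B \<and> (\<forall>i\<in>{1..n}. wt B (c 0) i = fund 1 i)"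
    using c_in wt_chain chain_wt_0[OF n] by simp
next
  fix b assume b: "b \<in> elts B \<and> (\<forall>i\<in>{1..n}. wt B b i = fund 1 i)"
  have "ht b = height ty n (fund 1)" unfolding ht_def using b by (intro height_cong) blast
  then have "ht b = 2 * int m" using height_fund_1[OF n] by simp
  then show "b = c 0"
    using b ht_z ht_c m_pos by (elim conjE elts_cases) auto
qed

lemma v_elt_eq: "v_elt n B = c m"
  unfolding v_elt_def elt_of_wt_def
proof (rule the_equality)
  show "c m \<in> elts B \<and> (\<forall>i\<in>{1..n}. wt B (c m) i = - fund 1 i)"
    using c_in wt_chain chain_wt_last[OF n] by simp
next
  fix b assume b: "b \<in> elts B \<and> (\<forall>i\<in>{1..n}. wt B b i = - fund 1 i)"
  have "ht b = height ty n (\<lambda>i. 0 - fund 1 i)" unfolding ht_def using b by (intro height_cong) simp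
  then have "ht b = - 2 * int m" using height_fund_1[OF n] height_diff[of ty n "\<lambda>_. 0" "fund 1"]
    by (simp add: height_zero)
  then show "b = c m"
    using b ht_z ht_c m_pos by (elim conjE elts_cases) auto
qed

end

subsection \<open>The local energy\<close>

lemma eop_tensor:
  "eop (tensor C D) i (x, y) = (if eps C i x > phi D i y
     then map_option (\<lambda>x'. (x', y)) (eop C i x) else map_option (\<lambda>y'. (x, y')) (eop D i y))"
  by (simp add: tensor_def)

lemma fop_tensor:
  "fop (tensor C D) i (x, y) = (if eps C i x \<ge> phi D i y
     then map_option (\<lambda>x'. (x', y)) (fop C i x) else map_option (\<lambda>y'. (x, y')) (fop D i y))"
  by (simp add: tensor_def)

locale kr_energy = kr_chain +
  fixes R :: "'a \<times> 'a \<Rightarrow> 'a \<times> 'a" and H :: "'a \<times> 'a \<Rightarrow> int"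
  assumes R: "combinatorial_R n B B R"
    and H: "local_energy n B B R (u_elt n B) (u_elt n B) H"
begin

abbreviation "T \<equiv> tensor B B"

lemma R_ops:
  assumes "i \<in> {0..n}" "p \<in> elts B \<times> elts B"
  shows "R p \<in> elts B \<times> elts B"
    "eop T i (R p) = map_option R (eop T i p)" "fop T i (R p) = map_option R (fop T i p)"
proof -
  have iso: "crystal_iso {0..n} T T R" using R by (simp add: combinatorial_R_def)
  have el: "elts T = elts B \<times> elts B" by (simp add: tensor_def)
  show "R p \<in> elts B \<times> elts B"
    using iso assms(2) unfolding crystal_iso_def el bij_betw_def by blast
  show "eop T i (R p) = map_option R (eop T i p)" "fop T i (R p) = map_option R (fop T i p)"
    using iso assms unfolding crystal_iso_def el by blast+
qed

lemma R_fix_eop: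
  assumes "i \<in> {0..n}" "p \<in> elts B \<times> elts B" "R p = p" "eop T i p = Some q" shows "R q = q"
  using R_ops(2)[OF assms(1,2)] assms(3,4) by simp

lemma R_fix_fop:
  assumes "i \<in> {0..n}" "p \<in> elts B \<times> elts B" "R p = p" "fop T i p = Some q" shows "R q = q"
  using R_ops(3)[OF assms(1,2)] assms(3,4) by simp

lemma H_classical:
  assumes "i \<in> {1..n}" "p \<in> elts B \<times> elts B" "eop T i p = Some q" shows "H q = H p"
  using H assms unfolding local_energy_def by blast

text \<open>At an element fixed by R the two sides of action coincide, so the case of change 0
  cannot occur.\<close>

lemma H_0:
  assumes "p \<in> elts B \<times> elts B" "R p = p" "eop T 0 p = Some q"
  shows "H q = H p + (if eps B 0 (fst p) > phi B 0 (snd p) then - 1 else 1)"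
proof -
  have "H q - H p =
          (if e0_acts_left B B p \<and> e0_acts_left B B (R p) then - 1
           else if \<not> e0_acts_left B B p \<and> \<not> e0_acts_left B B (R p) then 1
           else 0)"
    using H assms(1,3) unfolding local_energy_def by blast
  then show ?thesis using assms(2) by (cases "e0_acts_left B B p") (simp_all add: e0_acts_left_def)
qed

lemma H_uu: "H (c 0, c 0) = 0"
  using H by (simp add: local_energy_def u_elt_eq)

text \<open>
  As \<open>e_0\<close> lowers this statistic by 1, only \<open>u \<otimes> u\<close> admits four applications of \<open>e_0\<close>; hence
  R fixes it.
\<close>

definition eps2 :: "'a \<times> 'a \<Rightarrow> nat" where
  "eps2 p = eps B 0 (fst p) + eps B 0 (snd p)"

lemma eps2_eop:
  assumes "p \<in> elts B \<times> elts B" "eop T 0 p = Some q"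
  shows "q \<in> elts B \<times> elts B \<and> eps2 p = Suc (eps2 q)"
proof -
  obtain x y where p: "p = (x, y)" "x \<in> elts B" "y \<in> elts B" using assms(1) by auto
  show ?thesis
  proof (cases "eps B 0 x > phi B 0 y")
    case True
    then obtain x' where "eop B 0 x = Some x'" "q = (x', y)"
      using assms(2) by (auto simp: p eop_tensor)
    then show ?thesis
      using eps_Some[OF crystal _ p(2), of 0 x'] crystal_ops_closed(1)[OF crystal _ p(2), of 0 x'] p
      by (simp add: eps2_def)
  next
    case False
    then obtain y' where "eop B 0 y = Some y'" "q = (x, y')"
      using assms(2) by (auto simp: p eop_tensor)
    then show ?thesis
      using eps_Some[OF crystal _ p(3), of 0 y'] crystal_ops_closed(1)[OF crystal _ p(3), of 0 y'] p
      by (simp add: eps2_def)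
  qed
qed

lemma eps_0_le: "x \<in> elts B \<Longrightarrow> eps B 0 x \<le> 2 \<and> (eps B 0 x = 2 \<longrightarrow> x = c 0)"
proof (elim elts_cases)
  fix k assume "k \<le> m" "x = c k"
  then show ?thesis using eps_0(1) eps_0(3)[of k] by (cases "k = 0") simp_all
qed (simp add: eps_0)

text \<open>The first four steps form the 0-string from u (x) u to v (x) v that identifies the image
  of u (x) u under R. The other three carry the energy between classical components.\<close>

lemma eop_T_uu: "eop T 0 (c 0, c 0) = Some (z, c 0)"
  and eop_T_zu: "eop T 0 (z, c 0) = Some (c m, c 0)"
  and eop_T_vu: "eop T 0 (c m, c 0) = Some (c m, z)"
  and eop_T_vz: "eop T 0 (c m, z) = Some (c m, c m)"
  and eop_T_zz: "eop T 0 (z, z) = Some (z, c m)"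
  and eop_T_uz: "eop T 0 (c 0, z) = Some (z, z)"
  and eop_T_1u: "eop T 0 (c 1, c 0) = Some (c 1, z)"
  using eps_0 phi_0 m_ge by (simp_all add: eop_tensor eop_0_c0 eop_0_z)

lemma R_uu: "R (c 0, c 0) = (c 0, c 0)"
proof -
  have J: "0 \<in> {0..n}" by simp
  have up: "eop T 0 (R p) = Some (R q) \<and> R p \<in> elts B \<times> elts B"
    if "p \<in> elts B \<times> elts B" "eop T 0 p = Some q" for p q
    using R_ops(1,2)[OF J that(1)] that(2) by simp
  have "eps2 (R (c 0, c 0)) = Suc (eps2 (R (z, c 0)))" "R (c 0, c 0) \<in> elts B \<times> elts B"
    using up[OF _ eop_T_uu] eps2_eop c_in z_in by auto
  moreover have "eps2 (R (z, c 0)) = Suc (eps2 (R (c m, c 0)))"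
    using up[OF _ eop_T_zu] eps2_eop c_in z_in by auto
  moreover have "eps2 (R (c m, c 0)) = Suc (eps2 (R (c m, z)))"
    using up[OF _ eop_T_vu] eps2_eop c_in z_in by auto
  moreover have "eps2 (R (c m, z)) = Suc (eps2 (R (c m, c m)))"
    using up[OF _ eop_T_vz] eps2_eop c_in z_in by auto
  ultimately have "eps2 (R (c 0, c 0)) \<ge> 4" "R (c 0, c 0) \<in> elts B \<times> elts B" by auto
  moreover obtain x y where xy: "R (c 0, c 0) = (x, y)" by fastforce
  ultimately have "eps B 0 x + eps B 0 y \<ge> 4" "x \<in> elts B" "y \<in> elts B" by (auto simp: eps2_def)
  then have "x = c 0" "y = c 0" using eps_0_le[of x] eps_0_le[of y] by auto
  then show ?thesis by (simp add: xy)
qed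

lemma R_zu: "R (z, c 0) = (z, c 0)"
  using R_fix_eop[OF _ _ R_uu eop_T_uu] c_in by simp

lemma H_zu: "H (z, c 0) = - 1" and H_vu: "H (c m, c 0) = - 2"
proof -
  show zu: "H (z, c 0) = - 1"
    using H_0[OF _ R_uu eop_T_uu] c_in H_uu eps_0 phi_0 m_pos by simp
  show "H (c m, c 0) = - 2"
    using H_0[OF _ R_zu eop_T_zu] c_in z_in zu eps_0 phi_0 m_pos by simp
qed

text \<open>As \<open>z\<close> is classically trivial, the pairs with left factor \<open>z\<close>
  form one classical component; being fixed by R spreads from \<open>z\<close> (x) u down to
  \<open>z\<close> (x) v.\<close>

lemma R_zc: "k \<le> m \<Longrightarrow> R (z, c k) = (z, c k)"
proof (induction k)
  case (Suc k)
  have l: "lab k \<in> {1..n}" using chain_label_range[OF n, of k ty] Suc by simp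
  have "phi B (lab k) (c k) > 0"
    using phi_chain[OF l] chain_phi_pos[of ty n k] Suc by simp
  then have "fop T (lab k) (z, c k) = Some (z, c (Suc k))"
    using Suc fop_chain[OF _ l, of k] z_eps_phi[OF l] by (simp add: fop_tensor)
  then show ?case using R_fix_fop[of "lab k" "(z, c k)"] Suc l c_in z_in by simp
qed (simp add: R_zu)

lemma H_zc: "k \<le> m \<Longrightarrow> H (z, c k) = - 1"
proof (induction k)
  case (Suc k)
  have l: "lab k \<in> {1..n}" using chain_label_range[OF n, of k ty] Suc by simp
  have "eop T (lab k) (z, c (Suc k)) = Some (z, c k)"
    using Suc eop_chain[OF _ l, of "Suc k"] z_eps_phi[OF l] by (simp add: eop_tensor)
  then show ?case using H_classical[OF l, of "(z, c (Suc k))"] Suc c_in z_in by simp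
qed (simp add: H_zu)

text \<open>Being fixed is carried along the path \<open>z\<close> (x) v -> \<open>z\<close> (x)
  \<open>z\<close> -> u (x) \<open>z\<close> -> c_1 (x) \<open>z\<close> -> c_1 (x) u with labels 0,
  0, 1, 0. Its end is the highest weight element of the one component of X (x) X not met so
  far.\<close>

lemma R_zz: "R (z, z) = (z, z)" and R_uz: "R (c 0, z) = (c 0, z)"
  and R_1u: "R (c 1, c 0) = (c 1, c 0)"
proof -
  have "fop T 0 (z, c m) = Some (z, z)"
    using eps_0 phi_0 by (simp add: fop_tensor fop_0_cm)
  then show zz: "R (z, z) = (z, z)" using R_fix_fop[OF _ _ R_zc[of m], of 0] c_in z_in by simp
  have "fop T 0 (z, z) = Some (c 0, z)"
    using eps_0 phi_0 by (simp add: fop_tensor fop_0_z)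
  then show uz: "R (c 0, z) = (c 0, z)" using R_fix_fop[OF _ _ zz, of 0] z_in by simp
  have "fop B 1 (c 0) = Some (c 1)"
    using fop_chain[of 0 1] n m_pos by (simp add: chain_label_def)
  then have "fop T 1 (c 0, z) = Some (c 1, z)"
    using z_eps_phi[of 1] n by (simp add: fop_tensor)
  then have 1: "R (c 1, z) = (c 1, z)" using R_fix_fop[OF _ _ uz, of 1] c_in z_in n by simp
  have "fop T 0 (c 1, z) = Some (c 1, c 0)"
    using eps_0(3)[of 1] phi_0 m_ge by (simp add: fop_tensor fop_0_z)
  then show "R (c 1, c 0) = (c 1, c 0)" using R_fix_fop[OF _ _ 1, of 0] c_in z_in m_ge by simp
qed

lemma H_zz: "H (z, z) = - 2"
  using H_0[OF _ R_zz eop_T_zz] z_in H_zc[of m] eps_0 phi_0 by simp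

lemma H_cz: "k \<le> m \<Longrightarrow> H (c k, z) = - 1"
proof (induction k)
  case 0
  then show ?case using H_0[OF _ R_uz eop_T_uz] c_in z_in H_zz eps_0 phi_0 by simp
next
  case (Suc k)
  have l: "lab k \<in> {1..n}" using chain_label_range[OF n, of k ty] Suc by simp
  have "eps B (lab k) (c (Suc k)) > 0"
    using eps_chain[OF l Suc.prems] chain_eps_Suc[OF n, of k ty] Suc by simp
  then have "eop T (lab k) (c (Suc k), z) = Some (c k, z)"
    using Suc eop_chain[OF _ l, of "Suc k"] z_eps_phi[OF l] by (simp add: eop_tensor)
  then show ?case using H_classical[OF l, of "(c (Suc k), z)"] Suc c_in z_in by simp
qed

lemma H_1u: "H (c 1, c 0) = - 2"
  using H_0[OF _ R_1u eop_T_1u] c_in m_ge H_cz[of 1] eps_0(3)[of 1] phi_0(3)[of 0] by simp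

text \<open>An element \<open>c a\<close> has weight 0 iff \<open>2 * a = m\<close>.\<close>

definition rel :: "nat \<Rightarrow> nat \<Rightarrow> bool" where
  "rel a b \<longleftrightarrow> a \<le> b \<and> \<not> (a = b \<and> 2 * a = m)"

lemma middle_iff: "2 * a = m \<longleftrightarrow> a = n \<and> ty = D_twisted"
  using n by (cases ty) (simp_all add: chain_len_def, presburger)

lemma label_repeat:
  assumes "0 < a" "a < m"
  shows "lab a = lab (a - 1) \<longleftrightarrow> 2 * a = m"
  using chain_label_repeat[OF n, of "a - 1" ty] assms middle_iff by simp

lemma middle_bounds: "2 * a = m \<Longrightarrow> 0 < a \<and> a < m"
  using m_pos by auto

text \<open>Classical raising steps preserve \<open>H\<close>, so it remains to see that they
  preserve \<open>rel\<close> as well. Induction on \<open>a + b\<close> ends at the three highest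
  weight elements with right factor u.\<close>

lemma H_cc:
  assumes "a \<le> m" "b \<le> m"
  shows "H (c a, c b) = (if rel a b then 0 else - 2)"
  using assms
proof (induction "a + b" arbitrary: a b rule: less_induct)
  case less
  note ab = \<open>a \<le> m\<close> \<open>b \<le> m\<close>
  show ?case
  proof (cases "b = 0")
    case b: True
    \<comment> \<open>The first three cases are the highest weight elements, with known energies; in
      the last one the left factor can be raised.\<close>
    consider "a = 0" | "a = 1" | "a = m" "a > 1" | "1 < a" "a < m" using ab by linarith
    then show ?thesis
    proof cases
      case 4
      define i where "i = lab (a - 1)"
      have i: "i \<in> {1..n}" using chain_label_range[OF n, of "a - 1" ty] 4 by (simp add: i_def)
      have "i \<noteq> 1" using 4 by (auto simp: i_def chain_label_def)
      then have "phi B i (c 0) = 0" using phi_chain[OF i, of 0] n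
        by (simp add: chain_phi_def chain_label_def)
      moreover have "eps B i (c a) > 0"
        using eps_chain[OF i ab(1)] 4 by (simp add: chain_eps_def i_def)
      ultimately have "eop T i (c a, c 0) = Some (c (a - 1), c 0)"
        using eop_chain[OF ab(1) i] 4 by (simp add: eop_tensor i_def)
      then have "H (c a, c 0) = H (c (a - 1), c 0)"
        using H_classical[OF i] c_in ab by fastforce
      then show ?thesis using less.hyps[of "a - 1" 0] 4 b by (simp add: rel_def)
    qed (use b H_uu H_1u H_vu m_pos in \<open>auto simp: rel_def\<close>)
  next
    case b: False
    \<comment> \<open>With the label of the arrow into \<open>c b\<close>, the operator
      \<open>e_i\<close> never annihilates the pair: if the left factor is not raised, the right one
      is.\<close>
    define i where "i = lab (b - 1)"
    have i: "i \<in> {1..n}" using chain_label_range[OF n, of "b - 1" ty] b ab by (simp add: i_def)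
    have eps: "eps B i (c a) = chain_eps ty n a i" and phi: "phi B i (c b) = chain_phi ty n b i"
      using eps_chain[OF i] phi_chain[OF i] ab by auto
    have epos: "eps B i (c a) > 0 \<longleftrightarrow> a > 0 \<and> lab (a - 1) = i"
      by (simp add: eps chain_eps_def)
    have ppos: "phi B i (c b) > 0 \<longleftrightarrow> b < m \<and> lab b = i"
      by (simp add: phi chain_phi_pos)
    show ?thesis
    proof (cases "eps B i (c a) > phi B i (c b)")
      case True
      then have a: "a > 0" "lab (a - 1) = i" using epos by auto
      then have "eop T i (c a, c b) = Some (c (a - 1), c b)"
        using True eop_chain[OF ab(1) i] by (simp add: eop_tensor)
      then have "H (c a, c b) = H (c (a - 1), c b)"
        using H_classical[OF i] c_in ab by fastforce
      moreover have "rel (a - 1) b \<longleftrightarrow> rel a b"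
      proof -
        consider "a < b" | "a = b" | "a = Suc b" | "a > Suc b" by linarith
        then show ?thesis
        proof cases
          case 2
          \<comment> \<open>At the middle of the n-string both \<open>eps\<close> and
            \<open>phi\<close> are 1, so \<open>e_i\<close> acts on the right there.\<close>
          have "2 * a \<noteq> m"
          proof
            assume *: "2 * a = m"
            then have "a = n" "ty = D_twisted" using middle_iff by auto
            then have "eps B i (c a) \<le> 1" using eps by (simp add: chain_eps_def)
            moreover have "phi B i (c b) > 0"
              using ppos middle_bounds[OF *] label_repeat[of a] * a 2 by simp
            ultimately show False using True by simp
          qed
          then show ?thesis using 2 a by (auto simp: rel_def)
        next
          case 3
          then have "2 * b = m" using label_repeat[of b] a b ab i_def by simp
          then show ?thesis using 3 by (simp add: rel_def)
        qed (auto simp: rel_def)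
      qed
      ultimately show ?thesis using less.hyps[of "a - 1" b] a ab by simp
    next
      case False
      then have "eop T i (c a, c b) = Some (c a, c (b - 1))"
        using eop_chain[OF ab(2) i] b by (simp add: eop_tensor i_def)
      then have "H (c a, c b) = H (c a, c (b - 1))"
        using H_classical[OF i] c_in ab by fastforce
      moreover have "rel a (b - 1) \<longleftrightarrow> rel a b"
      proof -
        consider "a < b - 1" | "a = b - 1" | "a = b" | "a > b" by linarith
        then show ?thesis
        proof cases
          case 2
          \<comment> \<open>The step lands on the diagonal and must miss the exceptional pair. At
            the middle, \<open>e_i\<close> could act on the right only if a third arrow
            \<open>i\<close> followed.\<close>
          have "2 * a \<noteq> m"
          proof
            assume *: "2 * a = m"
            then have "eps B i (c a) > 0"
              using epos middle_bounds[OF *] label_repeat[of a] 2 by (simp add: i_def)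
            then have "phi B i (c b) > 0" using False by simp
            then have "lab b = lab (b - 1)" "b < m" using ppos by (auto simp: i_def)
            then have "2 * b = m" using label_repeat[of b] b by simp
            then show False using * 2 b by simp
          qed
          then show ?thesis using 2 b by (auto simp: rel_def)
        next
          case 3
          \<comment> \<open>Leaving the diagonal by raising the right factor is possible only at the
            exceptional pair, where \<open>rel\<close> fails already.\<close>
          have "eps B i (c a) > 0" using epos 3 b by (simp add: i_def)
          then have "phi B i (c b) > 0" using False by simp
          then have "lab b = lab (b - 1)" "b < m" using ppos by (auto simp: i_def)
          then have "2 * b = m" using label_repeat[of b] b by simp
          then show ?thesis using 3 b by (auto simp: rel_def)
        qed (use b in \<open>auto simp: rel_def\<close>)
      qed
      ultimately show ?thesis using less.hyps[of a "b - 1"] b ab by simp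
    qed
  qed
qed

end

subsection \<open>Solitons\<close>

text \<open>\<open>x\<close> is the left neighbour of the list and \<open>u\<close> its right
  neighbour. Reading from the left gives a structural recursion, whereas \<open>energy\<close> is
  indexed from the right.\<close>

primrec path_energy :: "('a \<times> 'a \<Rightarrow> int) \<Rightarrow> 'a \<Rightarrow> 'a \<Rightarrow> 'a list \<Rightarrow> int" where
  "path_energy H u x [] = H (x, u)"
| "path_energy H u x (y # ys) = H (x, y) + path_energy H u y ys"

lemma path_energy_sum:
  "path_energy H u x p =
    (\<Sum>k\<le>length p. H ((rev p @ [x]) ! k, if k = 0 then u else (rev p @ [x]) ! (k - 1)))"
proof (induction p arbitrary: x)
  case (Cons y p)
  let ?q = "rev p @ [y]"
  have "path_energy H u x (y # p) = H (x, y) + (\<Sum>k\<le>length p. H (?q ! k, if k = 0 then u else ?q ! (k - 1)))"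
    by (simp only: path_energy.simps Cons.IH)
  moreover have "(\<Sum>k\<le>length p. H ((?q @ [x]) ! k, if k = 0 then u else (?q @ [x]) ! (k - 1))) =
    (\<Sum>k\<le>length p. H (?q ! k, if k = 0 then u else ?q ! (k - 1)))"
    by (intro sum.cong refl) (auto simp: nth_append)
  moreover have "H ((?q @ [x]) ! Suc (length p), (?q @ [x]) ! length p) = H (x, y)"
    by (simp add: nth_append)
  then have "(\<Sum>k\<le>length (y # p). H ((?q @ [x]) ! k, if k = 0 then u else (?q @ [x]) ! (k - 1))) =
    (\<Sum>k\<le>length p. H ((?q @ [x]) ! k, if k = 0 then u else (?q @ [x]) ! (k - 1))) + H (x, y)"
    by simp
  ultimately show ?case by (simp only: rev.simps)
qed simp

lemma energy_state_of:
  assumes "H (u, u) = 0"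
  shows "energy H u (state_of u p) = path_energy H u u p"
proof -
  let ?g = "\<lambda>k. H (state_of u p k, if k = 0 then u else state_of u p (k - 1))"
  \<comment> \<open>The index \<open>length p\<close> has to stay: it is the pair of the last u on
    the left with the first factor of \<open>p\<close>.\<close>
  have "?g k = 0" if "k > length p" for k
    using that assms by (auto simp: state_of_def)
  then have "{k. ?g k \<noteq> 0} \<subseteq> {..length p}" by (auto simp: not_less[symmetric])
  then have "energy H u (state_of u p) = sum ?g {..length p}"
    unfolding energy_def by (intro Sum_any.expand_superset) simp
  also have "\<dots> = path_energy H u u p"
    unfolding path_energy_sum
    by (intro sum.cong refl) (auto simp: state_of_def nth_append)
  finally show ?thesis .
qed

lemma apply_es_Nil: "apply_es C [] b = Some b"
  by (simp add: apply_es_def)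

lemma apply_es_snoc: "apply_es C (w @ [i]) b = Option.bind (eop C i b) (apply_es C w)"
proof -
  have "foldr (\<lambda>i x. Option.bind x (eop C i)) w None = None" by (induction w) auto
  then show ?thesis by (cases "eop C i b") (simp_all add: apply_es_def)
qed

section \<open>Soliton length and order in chain indices\<close>

context kr_chain
begin

lemma label_1_iff: "k < m \<Longrightarrow> lab k = 1 \<longleftrightarrow> k = 0 \<or> Suc k = m"
  using n m_ge_n by (auto simp: chain_label_def)

text \<open>Counts the arrows labelled 1 between \<open>c 0\<close> and \<open>c k\<close>; only the
  first and the last arrow of the chain have this label.\<close>

definition letters1 :: "nat \<Rightarrow> nat" where
  "letters1 k = (if k = 0 then 0 else if k < m then 1 else 2)"

lemma letters1_Suc: "k < m \<Longrightarrow> letters1 (Suc k) = letters1 k + (if lab k = 1 then 1 else 0)"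
  using label_1_iff[of k] m_ge by (auto simp: letters1_def)

text \<open>Each chain element admits at most one raising operator, so the word is forced. The last
  letter acts first, hence the induction from the right.\<close>

lemma apply_es_count:
  assumes "apply_es B w (c k) = Some (c 0)" "set w \<subseteq> {1..n}" "k \<le> m"
  shows "count_list w 1 = letters1 k"
  using assms
proof (induction w arbitrary: k rule: rev_induct)
  case Nil
  then show ?case using c_eq_iff[of k 0] by (simp add: apply_es_Nil letters1_def)
next
  case (snoc i w)
  have i: "i \<in> {1..n}" using snoc.prems(2) by simp
  have "eop B i (c k) \<noteq> None" using snoc.prems(1) by (intro notI) (simp add: apply_es_snoc)
  then have k: "k > 0" "lab (k - 1) = i" "eop B i (c k) = Some (c (k - 1))"
    using eop_chain[OF snoc.prems(3) i] by (auto split: if_splits)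
  then have "count_list w 1 = letters1 (k - 1)"
    using snoc.IH[of "k - 1"] snoc.prems by (simp add: apply_es_snoc)
  then show ?case using letters1_Suc[of "k - 1"] k snoc.prems(3) by simp
qed

lemma apply_es_exists:
  "k \<le> m \<Longrightarrow> \<exists>w. set w \<subseteq> {1..n} \<and> apply_es B w (c k) = Some (c 0)"
proof (induction k)
  case 0
  then show ?case by (intro exI[of _ "[]"]) (simp add: apply_es_Nil)
next
  case (Suc k)
  then obtain w where w: "set w \<subseteq> {1..n}" "apply_es B w (c k) = Some (c 0)" by auto
  have l: "lab k \<in> {1..n}" using chain_label_range[OF n, of k ty] Suc by simp
  have "apply_es B (w @ [lab k]) (c (Suc k)) = Some (c 0)"
    using eop_chain[OF Suc.prems l] w by (simp add: apply_es_snoc)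
  then show ?case using w(1) l by (intro exI[of _ "w @ [lab k]"]) simp
qed

lemma N1_c:
  assumes "k \<le> m" shows "N1 n B z (c k) = letters1 k"
proof -
  obtain w where w: "set w \<subseteq> {1..n}" "apply_es B w (c k) = Some (c 0)"
    using apply_es_exists[OF assms] by blast
  have "(THE j. \<exists>w. set w \<subseteq> {1..n} \<and> apply_es B w (c k) = Some (c 0) \<and> j = count_list w 1)
    = letters1 k"
    by (rule the_equality) (use w apply_es_count[OF _ _ assms] in metis)+
  then show ?thesis using c_neq_z(1)[OF assms] by (simp add: N1_def u_elt_eq)
qed

text \<open>Apart from u, every factor counts 1, the empty element by convention, except v, whose
  path to u uses the label 1 twice.\<close>

lemma soliton_length_eq:
  assumes "set p \<subseteq> elts B" "c 0 \<notin> set p"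
  shows "soliton_length n B z p = length p + count_list p (c m)"
proof -
  have "N1 n B z x = 1 + (if x = c m then 1 else 0)" if x: "x \<in> elts B" "x \<noteq> c 0" for x
    using x(1)
  proof (cases rule: elts_cases)
    case 1
    then show ?thesis using c_neq_z(2)[of m] by (simp add: N1_def)
  next
    case (2 k)
    then have "0 < k" using x(2) by (intro gr0I) simp
    then show ?thesis using 2 N1_c[of k] c_eq_iff[of k m] by (auto simp: letters1_def)
  qed
  then show ?thesis using assms by (induction p) (auto simp: soliton_length_def)
qed

lemma kr_le_c:
  assumes "a \<le> b" "b \<le> m" shows "kr_le n B X z (c a) (c b)"
  using assms
proof (induction rule: dec_induct)
  case (step k)
  have l: "lab k \<in> {1..n}" using chain_label_range[OF n, of k ty] step by simp
  have "fop B (lab k) (c k) = Some (c (Suc k))" using fop_chain[OF _ l, of k] step by simp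
  then have "(c k, c (Suc k)) \<in> arrows {1..n} (subcrystal X B)"
    using l step by (auto simp: arrows_def X_eq)
  then show ?case
    using step unfolding kr_le_def by (auto intro: rtrancl_into_rtrancl)
qed (simp add: kr_le_def)

lemma kr_le_z: "a \<le> m \<Longrightarrow> kr_le n B X z (c a) z"
  using kr_le_c[of a m] unfolding kr_le_def v_elt_eq by (auto intro: rtrancl_into_rtrancl)

end

section \<open>Paths of extremal energy\<close>

context kr_energy
begin

abbreviation "E \<equiv> path_energy H (c 0)"

text \<open>These bounds leave no slack at energy -2: whatever follows a chain element costs at
  least 2, and \<open>z\<close> can afford no successor. The condition on \<open>a\<close> and
  \<open>ys\<close> excludes the free pair u (x) u. The bounds are proved together because the next
  factor may be of either kind.\<close>

lemma E_le:
  assumes "set ys \<subseteq> elts B - {c 0}"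
  shows "a \<le> m \<Longrightarrow> ys \<noteq> [] \<or> a \<noteq> 0 \<Longrightarrow> E (c a) ys \<le> - 2"
    and "E z ys \<le> - 1" and "ys \<noteq> [] \<Longrightarrow> E z ys \<le> - 3"
  using assms
proof (induction ys arbitrary: a)
  case Nil
  case 1
  then show ?case using H_cc[of a 0] by (simp add: rel_def)
next
  case Nil
  case 2
  then show ?case using H_zu by simp
next
  case Nil
  case 3
  then show ?case by simp
next
  case (Cons y ys)
  have ys: "set ys \<subseteq> elts B - {c 0}" if "set (y # ys) \<subseteq> elts B - {c 0}" using that by simp
  have y: "y = z \<or> (\<exists>b. y = c b \<and> b \<le> m \<and> b \<noteq> 0)" if "set (y # ys) \<subseteq> elts B - {c 0}"
  proof -
    have "y \<in> elts B" "y \<noteq> c 0" using that by auto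
    then show ?thesis by (metis elts_cases)
  qed
  {
    case 1
    from y[OF 1(3)] show ?case
    proof (elim disjE exE conjE)
      assume "y = z"
      then show ?thesis using Cons.IH(2)[OF ys] 1 H_cz by simp
    next
      fix b assume "y = c b" "b \<le> m" "b \<noteq> 0"
      then show ?thesis using Cons.IH(1)[of b] ys 1 H_cc[of a b] by auto
    qed
  next
    case 2
    have "E z (y # ys) \<le> - 3"
      using y[OF 2]
    proof (elim disjE exE conjE)
      assume "y = z"
      then show ?thesis using Cons.IH(2)[OF ys] 2 H_zz by simp
    next
      fix b assume "y = c b" "b \<le> m" "b \<noteq> 0"
      then show ?thesis using Cons.IH(1)[of b] ys 2 H_zc[of b] by auto
    qed
    then show ?case by simp
  next
    case 3
    show ?case
      using y[OF 3(2)]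
    proof (elim disjE exE conjE)
      assume "y = z"
      then show ?thesis using Cons.IH(2)[OF ys] 3 H_zz by simp
    next
      fix b assume "y = c b" "b \<le> m" "b \<noteq> 0"
      then show ?thesis using Cons.IH(1)[of b] ys 3 H_zc[of b] by auto
    qed
  }
qed

lemma rel_trans: "rel a b \<Longrightarrow> rel b d \<Longrightarrow> rel a d"
  by (auto simp: rel_def)

text \<open>The equality case of \<open>E_le\<close>. It includes \<open>a = 0\<close>, where the
  left neighbour is u itself.\<close>

lemma E_eq:
  assumes "set ys \<subseteq> elts B - {c 0}" "a \<le> m" "E (c a) ys = - 2"
  shows "\<exists>ks. set ks \<subseteq> {1..m} \<and> sorted_wrt rel (a # ks) \<and> (ys = map c ks \<or> ys = map c ks @ [z])"
  using assms
proof (induction ys arbitrary: a)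
  case Nil
  then show ?case by (intro exI[of _ "[]"]) simp
next
  case (Cons y ys)
  have ys: "set ys \<subseteq> elts B - {c 0}" and "y \<in> elts B" "y \<noteq> c 0" using Cons.prems(1) by auto
  from \<open>y \<in> elts B\<close> show ?case
  proof (cases rule: elts_cases)
    case 1
    \<comment> \<open>The pair ending in \<open>z\<close> costs 1, and a nonempty rest after
      \<open>z\<close> would cost at least 3.\<close>
    then have "E z ys = - 1" using Cons.prems H_cz by simp
    then have "ys = []" using E_le(3)[OF ys] by fastforce
    then show ?thesis using 1 by (intro exI[of _ "[]"]) simp
  next
    case (2 b)
    have "b \<noteq> 0" using 2 \<open>y \<noteq> c 0\<close> by (intro notI) simp
    have "E (c b) ys \<le> - 2" using E_le(1)[OF ys, of b] 2 \<open>b \<noteq> 0\<close> by simp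
    \<comment> \<open>The rest already uses up -2, so this pair must have energy 0.\<close>
    then have "rel a b" "E (c b) ys = - 2"
      using Cons.prems 2 H_cc[of a b] by (auto split: if_splits)
    then obtain ks where ks: "set ks \<subseteq> {1..m}" "sorted_wrt rel (b # ks)"
      "ys = map c ks \<or> ys = map c ks @ [z]"
      using Cons.IH[OF ys 2(1)] by blast
    have "sorted_wrt rel (a # b # ks)" using ks(2) \<open>rel a b\<close> rel_trans by auto
    then show ?thesis using ks 2 \<open>b \<noteq> 0\<close> by (intro exI[of _ "b # ks"]) auto
  qed
qed

text \<open>Sortedness by \<open>rel\<close> is strict at the middle index, the one index not
  related to itself.\<close>

lemma count_middle:
  assumes "sorted_wrt rel ks" "set ks \<subseteq> {..m}" "2 * k = m"
  shows "count_list (map c ks) (c k) \<le> 1"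
  using assms(1,2)
proof (induction ks)
  case (Cons j ks)
  show ?case
  proof (cases "j = k")
    case True
    then have "k \<notin> set ks" using Cons.prems(1) assms(3) by (auto simp: rel_def)
    moreover have "i = k" if "i \<in> set ks" "c i = c k" for i
      using that Cons.prems(2) assms(3) c_eq_iff[of i k] by auto
    ultimately have "c k \<notin> set (map c ks)" by auto
    then show ?thesis using True by (simp add: count_list_0_iff)
  next
    case False
    then have "c j \<noteq> c k" using c_eq_iff[of j k] Cons.prems(2) assms(3) by auto
    then show ?thesis using Cons by simp
  qed
qed simp

lemma soliton_shape:
  assumes "is_soliton n B H p"
  shows "set p \<subseteq> elts B - {c 0}"
    and "\<exists>ks. set ks \<subseteq> {1..m} \<and> sorted_wrt rel ks \<and> (p = map c ks \<or> p = map c ks @ [z])"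
proof -
  have p: "c 0 \<notin> set p" "is_state B (c 0) (state_of (c 0) p)"
    "energy H (c 0) (state_of (c 0) p) = H (the (fop B 1 (c 0)), c 0)"
    using assms unfolding is_soliton_def u_elt_eq Let_def by blast+
  have "rev p ! k \<in> elts B" if "k < length (rev p)" for k
    using p(2) that unfolding is_state_def state_of_def by (metis length_rev)
  then have "set (rev p) \<subseteq> elts B" by (auto simp: in_set_conv_nth simp del: set_rev length_rev)
  then show set_p: "set p \<subseteq> elts B - {c 0}" using p(1) by auto
  have "fop B 1 (c 0) = Some (c 1)"
    using fop_chain[of 0 1] n m_pos by (simp add: chain_label_def)
  \<comment> \<open>The prescribed soliton energy is that of c_1 (x) u, and the left neighbour of
    \<open>p\<close> is u.\<close>
  then have "E (c 0) p = - 2"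
    using p(3) energy_state_of[of H "c 0" p, OF H_uu] H_1u by simp
  from E_eq[OF set_p _ this] show
    "\<exists>ks. set ks \<subseteq> {1..m} \<and> sorted_wrt rel ks \<and> (p = map c ks \<or> p = map c ks @ [z])"
    by auto
qed

end

theorem proposition3p3:
  fixes ty :: affine_type and n l L :: nat
    and B :: "'a crystal" and X :: "'a set" and empt :: 'a
    and R :: "'a \<times> 'a \<Rightarrow> 'a \<times> 'a" and H :: "'a \<times> 'a \<Rightarrow> int"
    and p :: "'a list"
  assumes "n \<ge> 2"
    and "is_KR11 ty n B X empt"
    and "combinatorial_R n B B R"
    and "local_energy n B B R (u_elt n B) (u_elt n B) H"
    and "p \<in> solitons n B empt H l"
    and "length p = L + 1"
  shows "kr_less n B X empt (u_elt n B) (p ! 0)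
       \<and> (\<forall>k<L. kr_le n B X empt (p ! k) (p ! (k + 1)))
       \<and> (\<forall>y\<in>X. (\<forall>i\<in>{1..n}. wt B y i = 0) \<longrightarrow> count_list p y \<le> 1)
       \<and> count_list p empt \<le> 1
       \<and> l = L + count_list p (v_elt n B) + 1"
proof -
  obtain c where "kr_chain ty n B X empt c" using is_KR11_chain[OF assms(1,2)] by blast
  then interpret kr_energy ty n B X empt c R H
    unfolding kr_energy_def kr_energy_axioms_def using assms(3,4) by blast
  have sol: "is_soliton n B H p" "soliton_length n B empt p = l"
    using assms(5) by (simp_all add: solitons_def)
  note p_elts = soliton_shape(1)[OF sol(1)]
  obtain ks where ks: "set ks \<subseteq> {1..m}" "sorted_wrt rel ks" "p = map c ks \<or> p = map c ks @ [empt]"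
    using soliton_shape(2)[OF sol(1)] by blast
  have ks_le: "ks ! k \<le> m" if "k < length ks" for k
    using ks(1) nth_mem[OF that] by auto
  have nth: "p ! k = (if k < length ks then c (ks ! k) else empt)" if "k \<le> L" for k
    using that ks(3) assms(6) by (auto simp: nth_append)
  have "p ! 0 \<in> set p" using assms(6) by simp
  then have "p ! 0 \<noteq> c 0" using p_elts by blast
  moreover have "kr_le n B X empt (c 0) (p ! 0)"
    using nth[of 0] kr_le_c[of 0 "ks ! 0"] kr_le_z[of 0] ks_le[of 0] by auto
  ultimately have "kr_less n B X empt (u_elt n B) (p ! 0)"
    by (simp add: kr_less_def u_elt_eq)
  moreover have "kr_le n B X empt (p ! k) (p ! (k + 1))" if "k < L" for k
  proof -
    \<comment> \<open>Only the last factor can be \<open>empt\<close>, so a factor that has a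
      successor lies on the chain.\<close>
    have k: "k < length ks" using that ks(3) assms(6) by auto
    show ?thesis
    proof (cases "k + 1 < length ks")
      case True
      then have "rel (ks ! k) (ks ! (k + 1))" using sorted_wrt_nth_less[OF ks(2)] by simp
      then show ?thesis
        using nth[of k] nth[of "k + 1"] that k True ks_le[OF True] by (simp add: rel_def kr_le_c)
    next
      case False
      then show ?thesis using nth[of k] nth[of "k + 1"] that k kr_le_z[OF ks_le[OF k]] by simp
    qed
  qed
  moreover have "count_list p y \<le> 1" if y: "y \<in> X" "\<forall>i\<in>{1..n}. wt B y i = 0" for y
  proof -
    obtain k where k: "y = c k" "k \<le> m" using y(1) by (auto simp: X_eq)
    \<comment> \<open>Height 0 singles out the middle index of the chain.\<close>
    have "ht y = height ty n (\<lambda>_. 0)" unfolding ht_def using y(2) by (intro height_cong) blast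
    then have "2 * k = m" using k ht_c[of k] height_zero[of ty n] by simp
    then have "count_list (map c ks) y \<le> 1" using count_middle[OF ks(2)] ks(1) k by fastforce
    then show ?thesis using ks(3) c_neq_z(2)[OF k(2)] k(1) by auto
  qed
  moreover have "count_list p empt \<le> 1"
  proof -
    have "empt \<notin> set (map c ks)" using ks(1) z_notin by auto
    then show ?thesis using ks(3) by (auto simp: count_list_0_iff)
  qed
  moreover have "l = L + count_list p (v_elt n B) + 1"
    using soliton_length_eq[of p] p_elts sol(2) assms(6) by (auto simp: v_elt_eq)
  ultimately show ?thesis by blast
qed

end
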